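(* Let $K\subset\mathbb{R}^n$ be a closed set whose complement $K^c$ is a bounded open set, let $\mu\in(0,1]$ and $\alpha,\lambda>0$ with $r_\mu^\alpha(K)>\alpha+\lambda$, and assume $(K^{\oplus\alpha})^c$ is connected with finite geodesic diameter $\mathrm{Gdiam}((K^{\oplus\alpha})^c)<\infty$. Then $\mathrm{ax}_\lambda^\alpha(K)$ is a geodesic space with finite geodesic diameter. More precisely, for any $x,x'\in\mathrm{ax}_\lambda^\alpha(K)$ there exists a path $\gamma:[0,1]\to\mathrm{ax}_\lambda^\alpha(K)$ of minimal length with $\gamma(0)=x$, $\gamma(1)=x'$; its length is the geodesic distance between $x$ and $x'$ in $\mathrm{ax}_\lambda^\alpha(K)$, and $$\mathrm{length}(\gamma)\le\mathrm{Gdiam}(\mathrm{ax}_\lambda^\alpha(K))\le 2\frac{R_{\max}}{\tilde\mu^2}+\mathrm{Gdiam}\big((K^{\oplus\alpha})^c\big)\,e^{\frac{R_{\max}}{\alpha\tilde\mu^2}},$$ where $R_{\max}=R_{\max}(K)$ and $\tilde\mu=\tilde\mu_{\mu,\lambda}^{\alpha,\alpha}(K)$.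
   Context: For a closed set $K\subset\mathbb{R}^n$ with bounded open complement: $R_K(x)=d(x,K)$; $\Theta_K(x)=\{y\in K:\|x-y\|=R_K(x)\}$; for bounded $S$, $\mathrm{center}(S)$ and $\mathrm{radius}(S)$ are the center and radius of the smallest ball enclosing $S$; $\mathcal F_K(x)=\mathrm{radius}(\Theta_K(x))$; for $x\notin K$, $\nabla_K(x)=(x-\mathrm{center}(\Theta_K(x)))/R_K(x)$. $R_{\max}(K)=\max_{x\in K^c}R_K(x)$. Critical function: $\chi_K(t)=\inf\{\|\nabla_K(x)\|:R_K(x)=t\}$ for $t\in(0,R_{\max}(K)]$ (infimum of empty set $=1$). $K^{\oplus\alpha}=\{x:d(x,K)\le\alpha\}$. For $\mu\in(0,1]$, $\alpha\ge0$: $r_\mu^\alpha(K)=\inf\{t>\alpha:\chi_K(t)<\mu\}$. $\mathrm{ax}_\lambda^\alpha(K)=\{x:\mathcal F_{K^{\oplus\alpha}}(x)\ge\lambda\}$. $\tilde\mu_{\mu,\lambda}^{\alpha,\alpha'}(K)=\min\big(\mu,\sqrt{1-(\lambda/(r_\mu^{\alpha'}(K)-\alpha))^2}\big)$. For $A\subset\mathbb{R}^n$, $d_A(x,y)$ is the infimum of lengths of rectifiable paths in $A$ from $x$ to $y$, and $\mathrm{Gdiam}(A)=\sup_{x,y\in A}d_A(x,y)$. *)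

theory Defs
  imports "HOL-Analysis.Analysis" "HOL-Library.Extended_Real"
begin

definition RK :: "'a::euclidean_space set \<Rightarrow> 'a \<Rightarrow> real" where
  "RK K x = infdist x K"

definition ThetaK :: "'a::euclidean_space set \<Rightarrow> 'a \<Rightarrow> 'a set" where
  "ThetaK K x = {y \<in> K. dist x y = RK K x}"

definition enc_radius :: "'a::euclidean_space set \<Rightarrow> real" where
  "enc_radius S = Inf {r. \<exists>c. S \<subseteq> cball c r}"

definition enc_center :: "'a::euclidean_space set \<Rightarrow> 'a" where
  "enc_center S = (THE c. S \<subseteq> cball c (enc_radius S))"

definition FK :: "'a::euclidean_space set \<Rightarrow> 'a \<Rightarrow> real" where
  "FK K x = enc_radius (ThetaK K x)"

text \<open>Generalized gradient (meaningful for x outside K).\<close>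
definition nablaK :: "'a::euclidean_space set \<Rightarrow> 'a \<Rightarrow> 'a" where
  "nablaK K x = (x - enc_center (ThetaK K x)) /\<^sub>R RK K x"

definition Rmax :: "'a::euclidean_space set \<Rightarrow> real" where
  "Rmax K = Sup (RK K ` (- K))"

definition chiK :: "'a::euclidean_space set \<Rightarrow> real \<Rightarrow> real" where
  "chiK K t = (let S = {norm (nablaK K x) | x. RK K x = t} in if S = {} then 1 else Inf S)"

definition offset :: "'a::euclidean_space set \<Rightarrow> real \<Rightarrow> 'a set" where
  "offset K a = {x. infdist x K \<le> a}"

text \<open>mu-reach above alpha; the infimum of the empty set is +infinity.\<close>
definition reach_mu :: "real \<Rightarrow> real \<Rightarrow> 'a::euclidean_space set \<Rightarrow> ereal" where
  "reach_mu mu a K = Inf (ereal ` {t. t > a \<and> chiK K t < mu})"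

definition lambda_axis :: "real \<Rightarrow> real \<Rightarrow> 'a::euclidean_space set \<Rightarrow> 'a set" where
  "lambda_axis lam a K = {x. FK (offset K a) x \<ge> lam}"

text \<open>If the reach is infinite, lam/(r - a) is read as 0, so the second argument of min is 1.\<close>
definition mu_tilde :: "real \<Rightarrow> real \<Rightarrow> real \<Rightarrow> real \<Rightarrow> 'a::euclidean_space set \<Rightarrow> real" where
  "mu_tilde mu lam a a' K =
     (if reach_mu mu a' K = \<infinity> then mu
      else min mu (sqrt (1 - (lam / (real_of_ereal (reach_mu mu a' K) - a))\<^sup>2)))"

definition path_length :: "(real \<Rightarrow> 'a::metric_space) \<Rightarrow> ereal" where
  "path_length g = (SUP p \<in> {(n, t). t 0 = 0 \<and> t n = 1 \<and> (\<forall>i<n. t i \<le> t (Suc i))}.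
      ereal (\<Sum>i<fst p. dist (g (snd p (Suc i))) (g (snd p i))))"

definition rectifiable_path :: "(real \<Rightarrow> 'a::real_normed_vector) \<Rightarrow> bool" where
  "rectifiable_path g \<longleftrightarrow> path g \<and> path_length g < \<infinity>"

definition geodist :: "'a::real_normed_vector set \<Rightarrow> 'a \<Rightarrow> 'a \<Rightarrow> ereal" where
  "geodist A x y = (INF g \<in> {g. rectifiable_path g \<and> path_image g \<subseteq> A \<and>
                                 pathstart g = x \<and> pathfinish g = y}. path_length g)"

definition Gdiam :: "'a::real_normed_vector set \<Rightarrow> ereal" where
  "Gdiam A = (SUP x \<in> A. SUP y \<in> A. geodist A x y)"

end

theory Submission
  imports Defs
begin

text \<open>
  The function \<open>-R\<^sub>K\<^sup>2 / 2\<close> becomes convex after adding \<open>\<parallel>x\<parallel>\<^sup>2 / 2\<close>, so its implicit Euler step \<open>J\<^sub>h\<close>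
  (\<open>prox K h\<close>, for \<open>0 \<le> h < 1\<close>) is a globally defined \<open>1 / (1 - h)\<close>-Lipschitz map; it replaces the
  flow of \<open>\<nabla>\<^sub>K\<close>. One step increases both \<open>R\<^sub>K\<close> and \<open>F\<^sub>K\<close>, hence preserves the \<open>\<lambda>\<close>-axis, because
  \<open>F = (1 - \<alpha> / R\<^sub>K) F\<^sub>K\<close> for the offset. Off the axis \<open>\<parallel>\<nabla>\<^sub>K\<parallel>\<close> is at least \<open>\<mu>\<close> (the modified one), so
  each step multiplies \<open>R\<^sub>K\<^sup>2\<close> by at least \<open>1 / (1 - h (2 - h) \<mu>\<^sup>2)\<close>, and about
  \<open>ln (R\<^sub>m\<^sub>a\<^sub>x / \<alpha>) / (h \<mu>\<^sup>2)\<close> steps push the whole complement of the offset into the axis.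
  Two points of the axis are joined by the curves \<open>s \<mapsto> J\<^sub>s x\<close>, \<open>0 \<le> s \<le> h\<close>, of their iterates, which
  stay in the axis, and by the image of a path in the complement of the offset; the length bound
  follows as \<open>h\<close> tends to 0. The axis is compact, so a shortest path exists by Tychonoff's theorem,
  applied to maps \<open>[0,1] \<rightarrow> A\<close> that are Lipschitz up to an error tending to 0.
\<close>

section \<open>Enclosing balls and offsets\<close>

text \<open>The element of the hull that minimizes the norm of \<open>x - p\<close>. It is the
  center of the smallest ball enclosing \<open>ThetaK K x\<close>, by
  \<open>enclosing_ball_of_cospherical\<close>, so bounds on \<open>nablaK\<close> become facts
  about a metric projection.\<close>

definition foot :: "'a::euclidean_space set \<Rightarrow> 'a \<Rightarrow> 'a" where
  "foot K x = closest_point (convex hull ThetaK K x) x"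

lemma compact_ThetaK:
  assumes "closed K"
  shows "compact (ThetaK K x)"
proof -
  have "ThetaK K x = K \<inter> sphere x (RK K x)"
    by (auto simp: ThetaK_def)
  with assms show ?thesis by (simp add: closed_Int_compact)
qed

lemma ThetaK_nonempty:
  assumes "closed K" "K \<noteq> {}"
  shows "ThetaK K x \<noteq> {}"
proof -
  obtain y where "y \<in> K" "infdist x K = dist x y" using infdist_attains_inf[OF assms] by blast
  then have "y \<in> ThetaK K x" by (simp add: ThetaK_def RK_def)
  then show ?thesis by blast
qed

lemma foot_in:
  assumes "closed K" "K \<noteq> {}"
  shows "foot K x \<in> convex hull ThetaK K x"
  unfolding foot_def
proof (rule closest_point_in_set)
  show "closed (convex hull ThetaK K x)"
    by (intro compact_imp_closed compact_convex_hull compact_ThetaK assms)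
  show "convex hull ThetaK K x \<noteq> {}" using ThetaK_nonempty[OF assms] by simp
qed

lemma norm_foot_le:
  assumes "closed K" "p \<in> convex hull ThetaK K x"
  shows "norm (x - foot K x) \<le> norm (x - p)"
  using closest_point_le[OF compact_imp_closed[OF compact_convex_hull[OF compact_ThetaK[OF assms(1)]]] assms(2), of x]
  by (simp add: foot_def dist_norm)

lemma norm_foot_le_RK:
  assumes "closed K" "K \<noteq> {}"
  shows "norm (x - foot K x) \<le> RK K x"
proof -
  obtain q where "q \<in> ThetaK K x" using ThetaK_nonempty[OF assms] by blast
  then show ?thesis
    using norm_foot_le[OF assms(1) hull_inc[of q]] by (simp add: ThetaK_def dist_norm)
qed

section \<open>Smallest enclosing balls of sets on a sphere\<close>

lemma enclosing_radius_nonneg: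
  assumes "S \<noteq> {}" "S \<subseteq> cball c r"
  shows "0 \<le> r"
proof -
  obtain y where "y \<in> S" using assms(1) by blast
  then have "dist c y \<le> r" using assms(2) by auto
  then show ?thesis using zero_le_dist[of c y] by linarith
qed

lemma bdd_below_enclosing_radii:
  assumes "S \<noteq> {}"
  shows "bdd_below {r. \<exists>c. S \<subseteq> cball c r}"
proof (rule bdd_belowI[of _ 0])
  fix r assume "r \<in> {r. \<exists>c. S \<subseteq> cball c r}"
  then show "0 \<le> r" using enclosing_radius_nonneg[OF assms] by auto
qed

lemma ex_enclosing_radius:
  assumes "bounded S"
  shows "{r. \<exists>c. S \<subseteq> cball c r} \<noteq> {}"
proof -
  obtain c r where "S \<subseteq> cball c r" using assms by (auto simp: bounded_def subset_iff)
  then show ?thesis by blast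
qed

text \<open>The projection \<open>p\<close> of \<open>x\<close> onto the hull sees \<open>x\<close>
  and each point of \<open>S\<close> at a non-acute angle, which puts \<open>S\<close> into
  \<open>cball p F\<close>. That no other ball does as well is the inequality
  \<open>opt\<close>.\<close>

lemma enclosing_ball_of_cospherical:
  fixes S :: "'a::euclidean_space set"
  assumes "compact S" "S \<noteq> {}" and sph: "\<And>y. y \<in> S \<Longrightarrow> dist x y = R"
  defines "p \<equiv> closest_point (convex hull S) x"
  defines "F \<equiv> sqrt (R\<^sup>2 - (norm (x - p))\<^sup>2)"
  shows "enc_radius S = F" "enc_center S = p" "(norm (x - p))\<^sup>2 \<le> R\<^sup>2"
proof -
  have cl: "closed (convex hull S)" and ne: "convex hull S \<noteq> {}"
    using assms(1,2) by (auto simp: compact_convex_hull compact_imp_closed)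
  have pin: "p \<in> convex hull S" unfolding p_def by (rule closest_point_in_set[OF cl ne])
  obtain y0 where y0: "y0 \<in> S" using assms(2) by blast
  have dot: "(x - p) \<bullet> (y - p) \<le> 0" if "y \<in> S" for y
    unfolding p_def by (rule closest_point_dot) (use cl that in \<open>auto simp: hull_inc\<close>)
  have R2: "(norm (x - y))\<^sup>2 = R\<^sup>2" if "y \<in> S" for y
    using sph[OF that] by (simp add: dist_norm)
  have sq: "(norm (y - p))\<^sup>2 \<le> R\<^sup>2 - (norm (x - p))\<^sup>2" if "y \<in> S" for y
  proof -
    have "(norm (x - y))\<^sup>2 = (norm (x - p))\<^sup>2 + (norm (y - p))\<^sup>2 - 2 * ((x - p) \<bullet> (y - p))"
      by (simp add: power2_norm_eq_inner inner_diff inner_commute algebra_simps)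
    then show ?thesis using dot[OF that] R2[OF that] by linarith
  qed
  show le: "(norm (x - p))\<^sup>2 \<le> R\<^sup>2"
    using order_trans[OF zero_le_power2 sq[OF y0]] by linarith
  have F0: "F \<ge> 0" and F2: "F\<^sup>2 = R\<^sup>2 - (norm (x - p))\<^sup>2" using le by (auto simp: F_def)
  have sub: "S \<subseteq> cball p F"
  proof
    fix y assume "y \<in> S"
    then have "(norm (p - y))\<^sup>2 \<le> F\<^sup>2" using sq[of y] F2 by (simp add: norm_minus_commute[of p])
    then show "y \<in> cball p F" using power2_le_imp_le[OF _ F0] by (simp add: dist_norm)
  qed
  \<comment> \<open>The difference of squared distances to \<open>c\<close> and to \<open>x\<close>
    is affine in \<open>y\<close>, so its upper bound on \<open>S\<close> persists on the hull and
    can be read off at \<open>p\<close>. The surplus \<open>(norm (p - c))\<^sup>2\<close> gives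
    both the minimality of \<open>F\<close> and the uniqueness of the center.\<close>
  have opt: "F\<^sup>2 + (norm (p - c))\<^sup>2 \<le> r\<^sup>2 \<and> 0 \<le> r" if c: "S \<subseteq> cball c r" for c r
  proof -
    have aff: "(norm (y - c))\<^sup>2 - (norm (y - x))\<^sup>2 = 2 * ((x - c) \<bullet> y) + (c \<bullet> c - x \<bullet> x)" for y
      by (simp add: power2_norm_eq_inner inner_diff inner_commute algebra_simps)
    define H where "H = {y. (x - c) \<bullet> y \<le> (r\<^sup>2 - R\<^sup>2 - (c \<bullet> c - x \<bullet> x)) / 2}"
    have "S \<subseteq> H"
    proof
      fix y assume y: "y \<in> S"
      then have "norm (y - c) \<le> r" using c by (auto simp: dist_norm norm_minus_commute)
      then have "(norm (y - c))\<^sup>2 \<le> r\<^sup>2" by (simp add: power_mono)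
      then show "y \<in> H" using R2[OF y] aff[of y] by (simp add: H_def norm_minus_commute)
    qed
    then have "convex hull S \<subseteq> H"
      by (intro hull_minimal) (simp_all add: H_def convex_halfspace_le del: le_divide_eq_numeral1)
    then have "p \<in> H" using pin by blast
    then have "(norm (p - c))\<^sup>2 - (norm (p - x))\<^sup>2 \<le> r\<^sup>2 - R\<^sup>2"
      unfolding aff by (simp add: H_def)
    moreover have "0 \<le> r" by (rule enclosing_radius_nonneg[OF assms(2) c])
    ultimately show ?thesis using F2 by (simp add: norm_minus_commute)
  qed
  have "F \<le> r" if "S \<subseteq> cball c r" for c r
    using opt[OF that] zero_le_power2[of "norm (p - c)"]
    by (intro power2_le_imp_le[of F r]) linarith+
  then show rad: "enc_radius S = F"
    unfolding enc_radius_def using sub by (intro cInf_eq_minimum) auto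
  show "enc_center S = p"
    unfolding enc_center_def rad
  proof (rule the_equality)
    show "S \<subseteq> cball p F" by (rule sub)
  next
    fix c assume "S \<subseteq> cball c F"
    from opt[OF this] have "(norm (p - c))\<^sup>2 \<le> 0" by simp
    then show "c = p" by simp
  qed
qed

lemma
  assumes "closed K" "K \<noteq> {}"
  shows FK_eq: "FK K x = sqrt ((RK K x)\<^sup>2 - (norm (x - foot K x))\<^sup>2)"
    and nablaK_eq: "nablaK K x = (x - foot K x) /\<^sub>R RK K x"
proof -
  have "dist x y = RK K x" if "y \<in> ThetaK K x" for y using that by (simp add: ThetaK_def)
  from enclosing_ball_of_cospherical(1,2)[OF compact_ThetaK[OF assms(1)] ThetaK_nonempty[OF assms] this]
  show "FK K x = sqrt ((RK K x)\<^sup>2 - (norm (x - foot K x))\<^sup>2)"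
    and "nablaK K x = (x - foot K x) /\<^sub>R RK K x"
    by (simp_all add: FK_def nablaK_def foot_def)
qed

lemma enc_radius_homothety:
  fixes S :: "'a::euclidean_space set"
  assumes "k > 0" "S \<noteq> {}" "bounded S"
  shows "enc_radius ((\<lambda>y. x + k *\<^sub>R (y - x)) ` S) = k * enc_radius S"
proof -
  let ?T = "\<lambda>y. x + k *\<^sub>R (y - x)"
  let ?E = "\<lambda>S. {r. \<exists>c. S \<subseteq> cball c r}"
  have d: "dist (?T a) (?T b) = k * dist a b" for a b
  proof -
    have "?T a - ?T b = k *\<^sub>R (a - b)" by (simp add: algebra_simps)
    then show ?thesis using assms(1) by (simp add: dist_norm)
  qed
  have surj: "?T (x + (1/k) *\<^sub>R (c - x)) = c" for c using assms(1) by simp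
  have "?E (?T ` S) = (\<lambda>r. k * r) ` ?E S"
  proof (intro set_eqI iffI)
    fix r assume "r \<in> ?E (?T ` S)"
    then obtain c' where "?T ` S \<subseteq> cball c' r" by blast
    moreover define c where "c = x + (1/k) *\<^sub>R (c' - x)"
    ultimately have c: "?T ` S \<subseteq> cball (?T c) r" using surj[of c'] by simp
    have "S \<subseteq> cball c (r / k)"
    proof
      fix y assume "y \<in> S"
      then have "dist (?T c) (?T y) \<le> r" using c by (simp add: image_subset_iff)
      then show "y \<in> cball c (r / k)" unfolding d using assms(1) by (simp add: field_simps)
    qed
    moreover have "r = k * (r / k)" using assms(1) by simp
    ultimately show "r \<in> (\<lambda>r. k * r) ` ?E S" by blast
  next
    fix r assume "r \<in> (\<lambda>r. k * r) ` ?E S"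
    then obtain c s where "S \<subseteq> cball c s" "r = k * s" by blast
    then have "?T ` S \<subseteq> cball (?T c) r" using assms(1) d[of c] by (auto simp del: dist_add_cancel dist_scaleR)
    then show "r \<in> ?E (?T ` S)" by blast
  qed
  moreover have "Inf ((\<lambda>r. k * r) ` ?E S) = k * Inf (?E S)" if "?E S \<noteq> {}"
  proof -
    show ?thesis
      using that assms(1) bdd_below_enclosing_radii[OF assms(2)] continuous_at_Inf_mono[of "\<lambda>r. k * r" "?E S"]
      by (simp add: mono_def mult_left_mono continuous_intros)
  qed
  ultimately show ?thesis
    unfolding enc_radius_def using ex_enclosing_radius[OF assms(3)] by simp
qed

section \<open>Nearest points and enclosing radius for offsets\<close>

lemma offset_closed: "closed (offset K a)"
  unfolding offset_def by (intro closed_Collect_le continuous_intros)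

lemma subset_offset: "a \<ge> 0 \<Longrightarrow> K \<subseteq> offset K a"
  by (auto simp: offset_def)

text \<open>A nearest point of the offset is found on the segment from \<open>x\<close> to a nearest
  point of \<open>K\<close>, at distance \<open>a\<close> before its end. The homothety with center
  \<open>x\<close> and ratio \<open>k\<close> expresses this.\<close>

lemma
  fixes K :: "'a::euclidean_space set"
  assumes K: "closed K" "K \<noteq> {}" and a: "0 \<le> a" and x: "a < RK K x"
  defines "k \<equiv> 1 - a / RK K x"
  shows RK_offset: "RK (offset K a) x = RK K x - a"
    and ThetaK_offset: "ThetaK (offset K a) x = (\<lambda>y. x + k *\<^sub>R (y - x)) ` ThetaK K x"
proof -
  let ?R = "RK K x"
  have R: "?R > 0" using a x by linarith
  have k: "k * ?R = ?R - a" "0 < k" "k \<le> 1" using R a x by (auto simp: k_def field_simps)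
  have ne: "offset K a \<noteq> {}" using subset_offset[OF a] K(2) by blast
  have lower: "?R - a \<le> dist x z" if "z \<in> offset K a" for z
    using that infdist_triangle[of x K z] by (simp add: offset_def RK_def)
  have img: "x + k *\<^sub>R (y - x) \<in> offset K a \<and> dist x (x + k *\<^sub>R (y - x)) = ?R - a"
    if "y \<in> ThetaK K x" for y
  proof
    have y: "y \<in> K" "norm (x - y) = ?R" using that by (auto simp: ThetaK_def dist_norm)
    have "x + k *\<^sub>R (y - x) - y = (1 - k) *\<^sub>R (x - y)" by (simp add: algebra_simps)
    then have "dist (x + k *\<^sub>R (y - x)) y = (1 - k) * ?R" using k y by (simp add: dist_norm)
    also have "\<dots> = a" using k by (simp add: algebra_simps)
    finally show "x + k *\<^sub>R (y - x) \<in> offset K a"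
      using infdist_le[OF y(1)] by (metis (mono_tags) offset_def mem_Collect_eq)
    show "dist x (x + k *\<^sub>R (y - x)) = ?R - a"
      using k y by (simp add: dist_norm norm_minus_commute)
  qed
  obtain y0 where y0: "y0 \<in> ThetaK K x" using ThetaK_nonempty[OF K] by blast
  show RK_off: "RK (offset K a) x = ?R - a"
  proof (rule antisym)
    show "RK (offset K a) x \<le> ?R - a" using img[OF y0] infdist_le[of _ "offset K a" x] by (metis RK_def)
    show "?R - a \<le> RK (offset K a) x"
      unfolding RK_def[of "offset K a"] infdist_notempty[OF ne]
      using ne lower by (intro cINF_greatest) auto
  qed
  show "ThetaK (offset K a) x = (\<lambda>y. x + k *\<^sub>R (y - x)) ` ThetaK K x"
  proof (intro set_eqI iffI)
    fix z assume "z \<in> ThetaK (offset K a) x"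
    then have z: "infdist z K \<le> a" "dist x z = ?R - a" unfolding ThetaK_def RK_off by (auto simp: offset_def)
    obtain y where y: "y \<in> K" "infdist z K = dist z y" using infdist_attains_inf[OF K] by blast
    have Ry: "?R \<le> dist x y" unfolding RK_def by (rule infdist_le[OF y(1)])
    then have eq: "dist x y = dist x z + dist z y" and xy: "dist x y = ?R" and zy: "dist z y = a"
      using z y dist_triangle[of x y z] by auto
    \<comment> \<open>Equality in the triangle inequality forces \<open>z\<close> onto the segment
      from \<open>x\<close> to \<open>y\<close>.\<close>
    have "norm (x - z) *\<^sub>R (z - y) = norm (z - y) *\<^sub>R (x - z)" using eq dist_triangle_eq by blast
    then have "(?R - a) *\<^sub>R (z - y) = a *\<^sub>R (x - z)" using z zy by (simp add: dist_norm)
    then have "?R *\<^sub>R z = ?R *\<^sub>R x + (?R - a) *\<^sub>R (y - x)" by (simp add: algebra_simps)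
    also have "\<dots> = ?R *\<^sub>R (x + k *\<^sub>R (y - x))" using k(1) by (simp add: scaleR_add_right mult.commute)
    finally have "z = x + k *\<^sub>R (y - x)" using R by simp
    moreover have "y \<in> ThetaK K x" using y xy by (simp add: ThetaK_def)
    ultimately show "z \<in> (\<lambda>y. x + k *\<^sub>R (y - x)) ` ThetaK K x" by blast
  next
    fix z assume "z \<in> (\<lambda>y. x + k *\<^sub>R (y - x)) ` ThetaK K x"
    then show "z \<in> ThetaK (offset K a) x" using img by (auto simp: ThetaK_def RK_off)
  qed
qed

text \<open>Rewrites the axis condition in terms of \<open>RK K\<close> and \<open>FK K\<close>
  alone, the two quantities that a proximal step increases.\<close>

lemma FK_offset:
  fixes K :: "'a::euclidean_space set"
  assumes "closed K" "K \<noteq> {}" "0 \<le> a" "a < RK K x"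
  shows "FK (offset K a) x = (1 - a / RK K x) * FK K x"
proof -
  have "0 < 1 - a / RK K x" using assms by (simp add: field_simps)
  then show ?thesis
    unfolding FK_def ThetaK_offset[OF assms]
    by (rule enc_radius_homothety[OF _ ThetaK_nonempty[OF assms(1,2)] compact_imp_bounded[OF compact_ThetaK[OF assms(1)]]])
qed

lemma FK_eq_0:
  assumes "x \<in> K"
  shows "FK K x = 0"
proof -
  have "ThetaK K x = {x}" using assms by (auto simp: ThetaK_def RK_def)
  moreover have "enc_radius {x} = 0"
    unfolding enc_radius_def
    using enclosing_radius_nonneg[of "{x}"] by (intro cInf_eq_minimum) (auto intro: exI[of _ x])
  ultimately show ?thesis by (simp add: FK_def)
qed

section \<open>Semicontinuity of nearest points and of the enclosing radius\<close>

text \<open>The points \<open>q n\<close> stay bounded because \<open>z\<close> and the distances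
  \<open>RK K (z n)\<close> converge; a subsequential limit inherits the distance by continuity of
  \<open>RK K\<close>.\<close>

lemma ThetaK_limit:
  fixes K :: "'a::euclidean_space set"
  assumes K: "closed K" and zlim: "z \<longlonglongrightarrow> y" and q: "\<And>n. q n \<in> ThetaK K (z n)"
  obtains w s where "strict_mono s" "(q \<circ> s) \<longlonglongrightarrow> w" "w \<in> ThetaK K y"
proof -
  have qK: "q n \<in> K" "norm (z n - q n) = RK K (z n)" for n
    using q[of n] by (auto simp: ThetaK_def dist_norm)
  have RKlim: "(\<lambda>n. RK K (z n)) \<longlonglongrightarrow> RK K y"
    unfolding RK_def by (intro tendsto_infdist zlim)
  have "bounded (range (\<lambda>n. RK K (z n)))" "bounded (range z)"
    using RKlim zlim by (auto intro: convergent_imp_bounded)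
  then obtain B C where BC: "\<And>n. norm (RK K (z n)) \<le> B" "\<And>n. norm (z n) \<le> C"
    by (auto simp: bounded_iff)
  have "norm (q n) \<le> B + C" for n
    using BC[of n] qK(2)[of n] norm_triangle_ineq4[of "z n" "z n - q n"] by simp
  then have "bounded (range q)" by (auto simp: bounded_iff)
  then obtain w s where s: "strict_mono s" "(q \<circ> s) \<longlonglongrightarrow> w"
    using bounded_imp_convergent_subsequence by blast
  have "w \<in> K" using closed_sequentially[OF K _ s(2)] qK(1) by simp
  moreover have "dist y w = RK K y"
  proof (rule LIMSEQ_unique)
    show "(\<lambda>n. dist ((z \<circ> s) n) ((q \<circ> s) n)) \<longlonglongrightarrow> dist y w"
      by (intro tendsto_dist LIMSEQ_subseq_LIMSEQ[OF zlim s(1)] s)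
    show "(\<lambda>n. dist ((z \<circ> s) n) ((q \<circ> s) n)) \<longlonglongrightarrow> RK K y"
      using LIMSEQ_subseq_LIMSEQ[OF RKlim s(1)] qK(2) by (simp add: dist_norm o_def)
  qed
  ultimately show ?thesis using that[OF s] by (simp add: ThetaK_def)
qed

text \<open>Upper semicontinuity of \<open>FK K\<close>: a ball around \<open>ThetaK K x\<close> of
  radius below \<open>l\<close>, slightly enlarged, would have to miss a nearest point of every
  \<open>u n\<close>, and these accumulate in \<open>ThetaK K x\<close>.\<close>

lemma closed_FK_superlevel:
  fixes K :: "'a::euclidean_space set"
  assumes K: "closed K" "K \<noteq> {}"
  shows "closed {x. FK K x \<ge> l}"
  unfolding closed_sequential_limits
proof (intro allI impI, elim conjE)
  fix u :: "nat \<Rightarrow> 'a" and x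
  assume u: "\<forall>n. u n \<in> {x. FK K x \<ge> l}" and lim: "u \<longlonglongrightarrow> x"
  show "x \<in> {x. FK K x \<ge> l}"
  proof (rule ccontr)
    assume "x \<notin> {x. FK K x \<ge> l}"
    then have "Inf {r. \<exists>c. ThetaK K x \<subseteq> cball c r} < l" by (simp add: FK_def enc_radius_def)
    from cInf_lessD[OF _ this] have "\<exists>r. (\<exists>c. ThetaK K x \<subseteq> cball c r) \<and> r < l"
      using ex_enclosing_radius[OF compact_imp_bounded[OF compact_ThetaK[OF K(1)]], of x] by auto
    then obtain r c where rc: "r < l" "ThetaK K x \<subseteq> cball c r"
      by blast
    \<comment> \<open>The gap between \<open>r\<close> and \<open>r'\<close> survives the passage to
      the limit, where the strict bound on \<open>y n\<close> becomes a weak one.\<close>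
    obtain r' where r': "r < r'" "r' < l" using rc(1) dense by blast
    have "\<exists>y \<in> ThetaK K (u n). dist c y > r'" for n
    proof (rule ccontr)
      assume "\<not> ?thesis"
      then have "ThetaK K (u n) \<subseteq> cball c r'" by (auto simp: not_less)
      moreover have "bdd_below {r. \<exists>c. ThetaK K (u n) \<subseteq> cball c r}"
        by (intro bdd_below_enclosing_radii ThetaK_nonempty K)
      ultimately have "FK K (u n) \<le> r'"
        unfolding FK_def enc_radius_def by (intro cInf_lower) auto
      moreover have "l \<le> FK K (u n)" using u by blast
      ultimately show False using r' by linarith
    qed
    then obtain y where y: "\<And>n. y n \<in> ThetaK K (u n)" "\<And>n. dist c (y n) > r'" by metis
    obtain z s where s: "strict_mono s" "(y \<circ> s) \<longlonglongrightarrow> z" and z: "z \<in> ThetaK K x"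
      using ThetaK_limit[OF K(1) lim y(1)] by blast
    have "dist c z \<le> r" using rc(2) z by auto
    moreover have "r' \<le> dist c z"
      by (rule LIMSEQ_le_const[OF tendsto_dist[OF tendsto_const s(2)]]) (use y(2) less_imp_le in auto)
    ultimately show False using r' by linarith
  qed
qed

section \<open>The implicit Euler step\<close>

lemma RK_nonneg: "0 \<le> RK K x"
  by (simp add: RK_def infdist_nonneg)

lemma RK_squared_semiconcave:
  fixes K :: "'a::euclidean_space set"
  assumes p: "p \<in> convex hull ThetaK K y"
  shows "(RK K z)\<^sup>2 \<le> (RK K y)\<^sup>2 + 2 * ((z - y) \<bullet> (y - p)) + (norm (z - y))\<^sup>2"
proof -
  define b where "b = ((RK K y)\<^sup>2 - (RK K z)\<^sup>2 + (norm (z - y))\<^sup>2) / 2 + (z - y) \<bullet> y"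
  have "ThetaK K y \<subseteq> {q. (z - y) \<bullet> q \<le> b}"
  proof
    fix q assume q: "q \<in> ThetaK K y"
    then have "RK K z \<le> norm (z - q)" and R: "norm (y - q) = RK K y"
      using infdist_le[of q K z] by (auto simp: ThetaK_def RK_def dist_norm)
    then have "(RK K z)\<^sup>2 \<le> (norm (z - q))\<^sup>2"
      by (intro power_mono RK_nonneg)
    also have "\<dots> = (norm (z - y))\<^sup>2 + 2 * ((z - y) \<bullet> (y - q)) + (norm (y - q))\<^sup>2"
      by (simp add: power2_norm_eq_inner inner_diff_left inner_diff_right inner_commute algebra_simps)
    finally show "q \<in> {q. (z - y) \<bullet> q \<le> b}"
      unfolding R by (simp add: b_def inner_diff_right field_simps)
  qed
  then have "convex hull ThetaK K y \<subseteq> {q. (z - y) \<bullet> q \<le> b}"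
    by (rule hull_minimal) (rule convex_halfspace_le)
  then have "(z - y) \<bullet> p \<le> b" using p by blast
  then show ?thesis by (simp add: b_def inner_diff_right field_simps)
qed

text \<open>Add the semiconcavity inequalities from \<open>y\<close> to \<open>y'\<close> and back:
  the values of \<open>RK K\<close> cancel. This is the monotonicity of the subdifferential of a
  convex function, and all contraction-type estimates below rest on it.\<close>

lemma ThetaK_one_sided_Lipschitz:
  fixes K :: "'a::euclidean_space set"
  assumes "p \<in> convex hull ThetaK K y" "p' \<in> convex hull ThetaK K y'"
  shows "(y' - y) \<bullet> ((y' - p') - (y - p)) \<le> (norm (y' - y))\<^sup>2"
proof -
  have "(y - y') \<bullet> (y' - p') = - ((y' - y) \<bullet> (y' - p'))" by (simp add: inner_diff_left)
  then show ?thesis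
    using RK_squared_semiconcave[OF assms(1), of y'] RK_squared_semiconcave[OF assms(2), of y]
    by (simp add: inner_diff_right[of _ "y' - p'"] norm_minus_commute[of y y'])
qed

definition prox_step :: "'a::euclidean_space set \<Rightarrow> real \<Rightarrow> 'a \<Rightarrow> 'a \<Rightarrow> 'a \<Rightarrow> bool" where
  "prox_step K h x y p \<longleftrightarrow> p \<in> convex hull ThetaK K y \<and> y - x = h *\<^sub>R (y - p)"

text \<open>The witness maximizes \<open>R\<^sub>K\<^sup>2 - \<parallel>x - \<cdot>\<parallel>\<^sup>2 / h\<close>; the first-order condition is obtained by
  separating \<open>y - (y - x) / h\<close> from the convex hull of \<open>\<Theta>\<^sub>K(y)\<close>.\<close>

lemma prox_step_exists:
  fixes K :: "'a::euclidean_space set"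
  assumes K: "closed K" "K \<noteq> {}" and h: "0 \<le> h" "h < 1"
  shows "\<exists>y p. prox_step K h x y p"
proof (cases "h = 0")
  case True
  then show ?thesis using foot_in[OF K, of x] by (auto simp: prox_step_def)
next
  case False
  then have h0: "h > 0" using h by simp
  let ?f = "\<lambda>y. (RK K y)\<^sup>2 - (norm (y - x))\<^sup>2 / h"
  \<comment> \<open>Beyond this radius the penalty outweighs the largest growth that the 1-Lipschitz
    function \<open>RK K\<close> allows, so a maximum over the ball is global.\<close>
  define \<rho> where "\<rho> = 2 * RK K x * h / (1 - h)"
  have \<rho>: "0 \<le> \<rho>" using h RK_nonneg[of K x] by (simp add: \<rho>_def)
  have "continuous_on (cball x \<rho>) ?f"
    unfolding RK_def using h0 by (intro continuous_intros) auto
  then obtain y where y: "y \<in> cball x \<rho>" "\<And>z. z \<in> cball x \<rho> \<Longrightarrow> ?f z \<le> ?f y"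
    using continuous_attains_sup[of "cball x \<rho>" ?f] \<rho> by auto
  have far: "?f z \<le> ?f x" if "z \<notin> cball x \<rho>" for z
  proof -
    let ?d = "norm (z - x)"
    have "RK K z \<le> RK K x + ?d" using infdist_triangle[of z K x] by (simp add: RK_def dist_norm)
    then have "(RK K z)\<^sup>2 \<le> (RK K x + ?d)\<^sup>2" by (intro power_mono RK_nonneg)
    moreover have "\<rho> \<le> ?d" using that by (simp add: dist_norm norm_minus_commute)
    then have "2 * RK K x * h \<le> ?d * (1 - h)" using h by (simp add: \<rho>_def field_simps)
    then have "?d * (2 * RK K x * h) \<le> ?d * (?d * (1 - h))" by (rule mult_left_mono) simp
    then have "(2 * RK K x * ?d + ?d\<^sup>2) * h \<le> ?d\<^sup>2" by (simp add: power2_eq_square algebra_simps)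
    then have "2 * RK K x * ?d + ?d\<^sup>2 \<le> ?d\<^sup>2 / h" using h0 by (simp add: pos_le_divide_eq)
    ultimately show ?thesis by (simp add: power2_sum)
  qed
  have max: "?f z \<le> ?f y" for z
    using y far[of z] order_trans[OF far y(2)[of x]] \<rho> by (cases "z \<in> cball x \<rho>") auto
  define v where "v = (y - x) /\<^sub>R h"
  have hv: "h *\<^sub>R v = y - x" using h0 by (simp add: v_def)
  \<comment> \<open>First-order condition in the direction \<open>u\<close>, with a nearest point
    that may depend on \<open>u\<close>; one for each direction is enough for the separation
    argument.\<close>
  have dir: "\<exists>q \<in> ThetaK K y. u \<bullet> (y - q) \<le> u \<bullet> v" for u
  proof -
    define e where "e n = inverse (real (Suc n))" for n
    have e: "e n > 0" for n by (simp add: e_def)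
    have elim: "e \<longlonglongrightarrow> 0" unfolding e_def by (rule LIMSEQ_inverse_real_of_nat)
    define z where "z n = y + e n *\<^sub>R u" for n
    have zlim: "z \<longlonglongrightarrow> y"
      unfolding z_def using tendsto_add[OF tendsto_const tendsto_scaleR[OF elim tendsto_const], of y u] by simp
    have "\<forall>n. \<exists>q. q \<in> ThetaK K (z n)" using ThetaK_nonempty[OF K] by blast
    then obtain q where q: "\<And>n. q n \<in> ThetaK K (z n)" by metis
    have qK: "q n \<in> K" "norm (z n - q n) = RK K (z n)" for n
      using q[of n] by (auto simp: ThetaK_def dist_norm)
    \<comment> \<open>Maximality at \<open>y\<close> bounds \<open>RK K (z n)\<close> from above.
      From below, \<open>q n\<close> is nearest to \<open>z n\<close> but only a competitor for
      \<open>y\<close>. The difference of the two bounds is divided by \<open>e n\<close>.\<close>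
    have est: "u \<bullet> (y - q n) \<le> u \<bullet> v + e n * ((norm u)\<^sup>2 / h)" for n
    proof -
      have zx: "z n - x = h *\<^sub>R v + e n *\<^sub>R u" by (simp add: z_def hv)
      have "(norm (z n - x))\<^sup>2 = h * (h * (norm v)\<^sup>2) + 2 * (e n * (h * (u \<bullet> v))) + e n * (e n * (norm u)\<^sup>2)"
        unfolding zx by (simp add: power2_norm_eq_inner inner_add_left inner_add_right inner_commute algebra_simps)
      then have 1: "(norm (z n - x))\<^sup>2 / h = h * (norm v)\<^sup>2 + 2 * (e n * (u \<bullet> v)) + e n * (e n * ((norm u)\<^sup>2 / h))"
        using h0 by (simp add: field_simps)
      have 2: "(norm (y - x))\<^sup>2 / h = h * (norm v)\<^sup>2"
        unfolding hv[symmetric] using h0 by (simp add: power_mult_distrib power2_eq_square)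
      have 3: "(RK K (z n))\<^sup>2 \<le> (RK K y)\<^sup>2 + 2 * (e n * (u \<bullet> v)) + e n * (e n * ((norm u)\<^sup>2 / h))"
        using max[of "z n"] 1 2 by linarith
      have "RK K y \<le> norm (y - q n)" using infdist_le[OF qK(1), of y n] by (simp add: RK_def dist_norm)
      then have 4: "(RK K y)\<^sup>2 \<le> (norm (y - q n))\<^sup>2" by (intro power_mono RK_nonneg)
      have "(RK K (z n))\<^sup>2 = (norm ((y - q n) + e n *\<^sub>R u))\<^sup>2"
        unfolding qK(2)[symmetric] by (simp add: z_def algebra_simps)
      also have "\<dots> = (norm (y - q n))\<^sup>2 + 2 * (e n * (u \<bullet> (y - q n))) + e n * (e n * (norm u)\<^sup>2)"
        by (simp only: power2_norm_eq_inner inner_add_left inner_add_right inner_scaleR_left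
            inner_scaleR_right inner_commute[of "y - q n" u]) (simp add: algebra_simps)
      finally have "2 * (e n * (u \<bullet> (y - q n))) \<le> 2 * (e n * (u \<bullet> v)) + e n * (e n * ((norm u)\<^sup>2 / h))"
        using 3 4 mult_nonneg_nonneg[OF less_imp_le[OF e] mult_nonneg_nonneg[OF less_imp_le[OF e] zero_le_power2]]
        by smt
      also have "\<dots> \<le> 2 * (e n * (u \<bullet> v)) + 2 * (e n * (e n * ((norm u)\<^sup>2 / h)))"
      proof -
        have "0 \<le> e n * (e n * ((norm u)\<^sup>2 / h))"
          by (intro mult_nonneg_nonneg divide_nonneg_nonneg) (use e[of n] h0 in auto)
        then show ?thesis by linarith
      qed
      finally have "e n * (u \<bullet> (y - q n)) \<le> e n * (u \<bullet> v + e n * ((norm u)\<^sup>2 / h))"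
        unfolding distrib_left by linarith
      then show ?thesis using e[of n] mult_le_cancel_left_pos by blast
    qed
    obtain w s where s: "strict_mono s" "(q \<circ> s) \<longlonglongrightarrow> w" and "w \<in> ThetaK K y"
      using ThetaK_limit[OF K(1) zlim q] by blast
    have "u \<bullet> (y - w) \<le> u \<bullet> v"
    proof (rule LIMSEQ_le)
      show "(\<lambda>n. u \<bullet> (y - (q \<circ> s) n)) \<longlonglongrightarrow> u \<bullet> (y - w)"
        by (intro tendsto_intros s)
      have "(\<lambda>n. u \<bullet> v + (e \<circ> s) n * ((norm u)\<^sup>2 / h)) \<longlonglongrightarrow> u \<bullet> v + 0 * ((norm u)\<^sup>2 / h)"
        by (intro tendsto_intros LIMSEQ_subseq_LIMSEQ[OF elim s(1)])
      then show "(\<lambda>n. u \<bullet> v + (e \<circ> s) n * ((norm u)\<^sup>2 / h)) \<longlonglongrightarrow> u \<bullet> v" by simp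
    qed (use est in auto)
    with \<open>w \<in> ThetaK K y\<close> show ?thesis by blast
  qed
  have "y - v \<in> convex hull ThetaK K y"
  proof (rule ccontr)
    assume "y - v \<notin> convex hull ThetaK K y"
    moreover have "closed (convex hull ThetaK K y)"
      by (intro compact_imp_closed compact_convex_hull compact_ThetaK K)
    ultimately obtain a b where ab: "a \<bullet> (y - v) < b" "\<And>q. q \<in> convex hull ThetaK K y \<Longrightarrow> a \<bullet> q > b"
      using separating_hyperplane_closed_point[OF convex_convex_hull] by blast
    obtain q where q: "q \<in> ThetaK K y" "(- a) \<bullet> (y - q) \<le> (- a) \<bullet> v" using dir by blast
    then have "a \<bullet> q \<le> a \<bullet> (y - v)" by (simp add: inner_diff_right)
    with ab(1) ab(2)[OF hull_inc[OF q(1)]] show False by linarith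
  qed
  then have "prox_step K h x y (y - v)" by (simp add: prox_step_def hv)
  then show ?thesis by blast
qed

lemma le_of_square_le_mult:
  fixes a b c :: real
  assumes "c * a\<^sup>2 \<le> b * a" "0 \<le> a" "0 \<le> b" "0 < c"
  shows "a \<le> b / c"
proof (cases "a = 0")
  case False
  then have "(c * a) * a \<le> b * a" "a > 0" using assms by (auto simp: power2_eq_square algebra_simps)
  then show ?thesis using assms(4) by (simp add: field_simps)
qed (use assms in simp)

text \<open>Take the inner product of \<open>x' - x\<close>, written through the end points and
  slopes, with \<open>y' - y\<close> and apply the one-sided bound. The case \<open>x = x'\<close>
  shows that the end point of a step is unique.\<close>

lemma prox_step_Lipschitz:
  assumes "prox_step K h x y p" "prox_step K h x' y' p'" "0 \<le> h" "h < 1"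
  shows "norm (y' - y) \<le> norm (x' - x) / (1 - h)"
proof (rule le_of_square_le_mult)
  have y: "y - x = h *\<^sub>R (y - p)" "y' - x' = h *\<^sub>R (y' - p')" using assms by (auto simp: prox_step_def)
  have "x' - x = (y' - y) - h *\<^sub>R ((y' - p') - (y - p))"
    unfolding scaleR_diff_right[of h "y' - p'"] y[symmetric] by simp
  then have "(y' - y) \<bullet> (x' - x) = (norm (y' - y))\<^sup>2 - h * ((y' - y) \<bullet> ((y' - p') - (y - p)))"
    by (simp only: inner_diff_right[of _ "y' - y"] inner_scaleR_right power2_norm_eq_inner)
  moreover have "h * ((y' - y) \<bullet> ((y' - p') - (y - p))) \<le> h * (norm (y' - y))\<^sup>2"
    using assms by (intro mult_left_mono ThetaK_one_sided_Lipschitz) (auto simp: prox_step_def)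
  moreover have "(y' - y) \<bullet> (x' - x) \<le> norm (x' - x) * norm (y' - y)"
    using norm_cauchy_schwarz[of "y' - y" "x' - x"] by (simp add: mult.commute)
  ultimately show "(1 - h) * (norm (y' - y))\<^sup>2 \<le> norm (x' - x) * norm (y' - y)"
    by (simp add: algebra_simps)
qed (use assms in auto)

lemma norm_hull_ThetaK_le:
  assumes "p \<in> convex hull ThetaK K y"
  shows "norm (y - p) \<le> RK K y"
proof -
  have "convex hull ThetaK K y \<subseteq> cball y (RK K y)"
    by (intro hull_minimal convex_cball) (auto simp: ThetaK_def)
  then show ?thesis using assms by (auto simp: dist_norm)
qed

text \<open>The same pairing with a common start and two step sizes. It makes
  \<open>s \<mapsto> prox K s x\<close> a Lipschitz curve from \<open>x\<close> to
  \<open>prox K h x\<close>.\<close>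

lemma prox_step_Lipschitz_time:
  assumes "prox_step K h x y p" "prox_step K h' x y' p'" "0 \<le> h'" "h' < 1"
  shows "norm (y' - y) \<le> \<bar>h' - h\<bar> * RK K y / (1 - h')"
proof (rule le_of_square_le_mult)
  let ?v = "y - p" and ?v' = "y' - p'"
  have y: "y - x = h *\<^sub>R ?v" "y' - x = h' *\<^sub>R ?v'" and p: "p \<in> convex hull ThetaK K y"
    using assms by (auto simp: prox_step_def)
  have "h' *\<^sub>R (?v' - ?v) = (y' - y) - (h' - h) *\<^sub>R ?v"
    unfolding scaleR_diff_right[of h' ?v'] scaleR_diff_left y[symmetric] by simp
  then have "h' * ((y' - y) \<bullet> (?v' - ?v)) = (norm (y' - y))\<^sup>2 - (h' - h) * ((y' - y) \<bullet> ?v)"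
    by (simp only: inner_diff_right[of _ "y' - y"] inner_scaleR_right[symmetric] power2_norm_eq_inner)
  moreover have "h' * ((y' - y) \<bullet> (?v' - ?v)) \<le> h' * (norm (y' - y))\<^sup>2"
    using assms by (intro mult_left_mono ThetaK_one_sided_Lipschitz) (auto simp: prox_step_def)
  moreover have "(h' - h) * ((y' - y) \<bullet> ?v) \<le> \<bar>h' - h\<bar> * (norm (y' - y) * RK K y)"
  proof -
    have "(h' - h) * ((y' - y) \<bullet> ?v) \<le> \<bar>h' - h\<bar> * \<bar>(y' - y) \<bullet> ?v\<bar>"
      by (simp add: abs_mult[symmetric])
    also have "\<bar>(y' - y) \<bullet> ?v\<bar> \<le> norm (y' - y) * norm ?v" by (rule Cauchy_Schwarz_ineq2)
    also have "norm ?v \<le> RK K y" by (rule norm_hull_ThetaK_le[OF p])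
    finally show ?thesis by (simp add: mult_left_mono)
  qed
  ultimately show "(1 - h') * (norm (y' - y))\<^sup>2 \<le> (\<bar>h' - h\<bar> * RK K y) * norm (y' - y)"
    by (simp add: algebra_simps)
qed (use assms RK_nonneg[of K y] in auto)

text \<open>Apply the one-sided bound between \<open>x\<close> and \<open>y\<close>, where
  \<open>y - x\<close> is \<open>h\<close> times the slope, and cancel \<open>h\<close>. Taking the
  foot for \<open>q\<close> compares with the smallest slope at \<open>x\<close>.\<close>

lemma prox_step_slope:
  assumes "prox_step K h x y p" "0 < h" "h < 1" "q \<in> convex hull ThetaK K x"
  shows "norm (y - p) \<le> norm (x - q) / (1 - h)"
proof (rule le_of_square_le_mult)
  let ?v = "y - p" and ?w = "x - q"
  have y: "y - x = h *\<^sub>R ?v" and p: "p \<in> convex hull ThetaK K y"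
    using assms by (auto simp: prox_step_def)
  have "h * (?v \<bullet> (?v - ?w)) \<le> h * (h * (norm ?v)\<^sup>2)"
    using ThetaK_one_sided_Lipschitz[OF assms(4) p] assms(2)
    unfolding y by (simp add: power_mult_distrib power2_eq_square mult.left_commute)
  then have "?v \<bullet> (?v - ?w) \<le> h * (norm ?v)\<^sup>2" using assms(2) by simp
  moreover have "?v \<bullet> ?w \<le> norm ?w * norm ?v"
    using norm_cauchy_schwarz[of ?v ?w] by (simp add: mult.commute)
  ultimately show "(1 - h) * (norm ?v)\<^sup>2 \<le> norm ?w * norm ?v"
    by (simp add: inner_diff_right[of _ ?v] left_diff_distrib power2_norm_eq_inner)
qed (use assms in auto)

text \<open>Semiconcavity based at the end point \<open>y\<close> and evaluated back at
  \<open>x\<close>: since the step is implicit, an upper bound for \<open>RK K x\<close> is a lower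
  bound for the growth.\<close>

lemma prox_step_RK_growth:
  assumes "prox_step K h x y p"
  shows "(RK K x)\<^sup>2 + h * (2 - h) * (norm (y - p))\<^sup>2 \<le> (RK K y)\<^sup>2"
proof -
  have y: "y - x = h *\<^sub>R (y - p)" and p: "p \<in> convex hull ThetaK K y"
    using assms by (auto simp: prox_step_def)
  have "x - y = - (h *\<^sub>R (y - p))" unfolding y[symmetric] by simp
  then have "(x - y) \<bullet> (y - p) = - (h * (norm (y - p))\<^sup>2)" "(norm (x - y))\<^sup>2 = h\<^sup>2 * (norm (y - p))\<^sup>2"
    by (simp_all add: dot_square_norm power_mult_distrib)
  then show ?thesis
    using RK_squared_semiconcave[OF p, of x] by (simp add: power2_eq_square algebra_simps)
qed

text \<open>With \<open>w\<close> the slope at \<open>x\<close> and \<open>v\<close> that at \<open>y\<close>, the bounds \<open>\<parallel>v\<parallel> \<le> \<parallel>w\<parallel> / (1 - h)\<close> and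
  \<open>R\<^sub>K(y)\<^sup>2 - R\<^sub>K(x)\<^sup>2 \<ge> h (2 - h) \<parallel>v\<parallel>\<^sup>2\<close> cancel exactly, because \<open>h (2 - h) + (1 - h)\<^sup>2 = 1\<close>.\<close>

lemma prox_step_FK_mono:
  assumes K: "closed K" "K \<noteq> {}" and s: "prox_step K h x y p" and h: "0 \<le> h" "h < 1"
  shows "FK K x \<le> FK K y"
proof (cases "h = 0")
  case True
  then show ?thesis using s by (simp add: prox_step_def)
next
  case False
  then have h0: "0 < h" using h by simp
  have "norm (y - p) \<le> norm (x - foot K x) / (1 - h)"
    by (rule prox_step_slope[OF s h0 h(2) foot_in[OF K]])
  then have "(1 - h) * norm (y - p) \<le> norm (x - foot K x)" using h by (simp add: field_simps)
  then have "((1 - h) * norm (y - p))\<^sup>2 \<le> (norm (x - foot K x))\<^sup>2"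
    using h by (intro power_mono) auto
  moreover have "(norm (y - foot K y))\<^sup>2 \<le> (norm (y - p))\<^sup>2"
    using norm_foot_le[OF K(1)] s by (intro power_mono) (auto simp: prox_step_def)
  moreover have "((1 - h) * norm (y - p))\<^sup>2 = (norm (y - p))\<^sup>2 - h * (2 - h) * (norm (y - p))\<^sup>2"
    by (simp add: power2_eq_square algebra_simps)
  ultimately have "(RK K x)\<^sup>2 - (norm (x - foot K x))\<^sup>2 \<le> (RK K y)\<^sup>2 - (norm (y - foot K y))\<^sup>2"
    using prox_step_RK_growth[OF s] by linarith
  then show ?thesis unfolding FK_eq[OF K] by (rule real_sqrt_le_mono)
qed

section \<open>The proximal map\<close>

text \<open>For \<open>0 \<le> h < 1\<close> on a nonempty closed \<open>K\<close> the choice is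
  harmless: a step exists by \<open>prox_step_exists\<close>, and its end point is unique by
  \<open>prox_step_Lipschitz\<close>.\<close>

definition prox :: "'a::euclidean_space set \<Rightarrow> real \<Rightarrow> 'a \<Rightarrow> 'a" where
  "prox K h x = (SOME y. \<exists>p. prox_step K h x y p)"

lemma prox_stepE:
  assumes "closed K" "K \<noteq> {}" "0 \<le> h" "h < 1"
  obtains p where "prox_step K h x (prox K h x) p"
  using someI_ex[OF prox_step_exists[OF assms, of x]] that by (auto simp: prox_def)

lemma prox_0:
  assumes "closed K" "K \<noteq> {}"
  shows "prox K 0 x = x"
proof -
  obtain p where "prox_step K 0 x (prox K 0 x) p" using prox_stepE[OF assms, of 0] by auto
  then show ?thesis by (simp add: prox_step_def)
qed

lemma prox_Lipschitz:
  assumes "closed K" "K \<noteq> {}" "0 \<le> h" "h < 1"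
  shows "dist (prox K h x) (prox K h x') \<le> dist x x' / (1 - h)"
proof -
  obtain p where p: "prox_step K h x (prox K h x) p" using prox_stepE[OF assms] .
  obtain p' where p': "prox_step K h x' (prox K h x') p'" using prox_stepE[OF assms] .
  show ?thesis using prox_step_Lipschitz[OF p' p assms(3,4)] by (simp add: dist_norm)
qed

lemma prox_RK_mono:
  assumes "closed K" "K \<noteq> {}" "0 \<le> h" "h < 1"
  shows "RK K x \<le> RK K (prox K h x)"
proof -
  obtain p where p: "prox_step K h x (prox K h x) p" using prox_stepE[OF assms] .
  have "0 \<le> h * (2 - h) * (norm (prox K h x - p))\<^sup>2" using assms by simp
  then show ?thesis
    using prox_step_RK_growth[OF p] by (intro power2_le_imp_le[OF _ RK_nonneg]) linarith
qed

lemma prox_FK_mono: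
  assumes "closed K" "K \<noteq> {}" "0 \<le> h" "h < 1"
  shows "FK K x \<le> FK K (prox K h x)"
proof -
  obtain p where p: "prox_step K h x (prox K h x) p" using prox_stepE[OF assms] .
  show ?thesis by (rule prox_step_FK_mono[OF assms(1,2) p assms(3,4)])
qed

lemma prox_Lipschitz_time:
  assumes "closed K" "K \<noteq> {}" "0 \<le> h" "h < 1" "0 \<le> h'" "h' < 1"
  shows "dist (prox K h x) (prox K h' x) \<le> \<bar>h - h'\<bar> * RK K (prox K h x) / (1 - h')"
proof -
  obtain p where p: "prox_step K h x (prox K h x) p" using prox_stepE[OF assms(1-4)] .
  obtain p' where p': "prox_step K h' x (prox K h' x) p'" using prox_stepE[OF assms(1,2,5,6)] .
  show ?thesis
    using prox_step_Lipschitz_time[OF p p' assms(5,6)] by (simp add: dist_norm norm_minus_commute abs_minus_commute)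
qed

text \<open>Replaces the unspecified \<open>p\<close> by the foot, whose slope is the one that the
  critical function controls.\<close>

lemma prox_RK_growth:
  assumes "closed K" "K \<noteq> {}" "0 \<le> h" "h < 1"
  shows "(RK K x)\<^sup>2 + h * (2 - h) * (norm (prox K h x - foot K (prox K h x)))\<^sup>2 \<le> (RK K (prox K h x))\<^sup>2"
proof -
  obtain p where p: "prox_step K h x (prox K h x) p" using prox_stepE[OF assms] .
  then have "norm (prox K h x - foot K (prox K h x)) \<le> norm (prox K h x - p)"
    by (intro norm_foot_le assms) (auto simp: prox_step_def)
  then have "h * (2 - h) * (norm (prox K h x - foot K (prox K h x)))\<^sup>2 \<le> h * (2 - h) * (norm (prox K h x - p))\<^sup>2"
    using assms by (intro mult_left_mono power_mono) auto
  then show ?thesis using prox_step_RK_growth[OF p] by linarith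
qed

section \<open>Lengths of paths and shortest paths\<close>

lemma sum_le_path_length:
  assumes "t 0 = 0" "t n = 1" "\<And>i. i < n \<Longrightarrow> t i \<le> t (Suc i)"
  shows "ereal (\<Sum>i<n. dist (g (t (Suc i))) (g (t i))) \<le> path_length g"
  unfolding path_length_def
  by (rule SUP_upper2[where i = "(n, t)"]) (use assms in auto)

lemma path_length_le:
  assumes "\<And>n t. t 0 = 0 \<Longrightarrow> t n = 1 \<Longrightarrow> (\<And>i. i < n \<Longrightarrow> t i \<le> t (Suc i)) \<Longrightarrow>
    ereal (\<Sum>i<n. dist (g (t (Suc i))) (g (t i))) \<le> L"
  shows "path_length g \<le> L"
  unfolding path_length_def by (rule SUP_least) (use assms in auto)

lemma partition_in_unit_interval:
  fixes t :: "nat \<Rightarrow> real"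
  assumes "t 0 = 0" "t n = 1" "\<And>i. i < n \<Longrightarrow> t i \<le> t (Suc i)" "i \<le> n"
  shows "t i \<in> {0..1}"
proof -
  have "t 0 \<le> t i" if "i \<le> n" for i
    using that
  proof (induction i)
    case (Suc i)
    then show ?case using assms(3)[of i] by simp
  qed simp
  moreover have "t (n - j) \<le> t n" for j
  proof (induction j)
    case (Suc j)
    show ?case
    proof (cases "j < n")
      case True
      then have "t (n - Suc j) \<le> t (n - j)" using assms(3)[of "n - Suc j"] by (simp add: Suc_diff_Suc)
      then show ?thesis using Suc by linarith
    qed (use Suc in simp)
  qed simp
  from this[of "n - i"] have "t i \<le> t n" using assms(4) by simp
  ultimately show ?thesis using assms by auto
qed

lemma dist_le_path_length: "ereal (dist (pathstart g) (pathfinish g)) \<le> path_length g"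
  using sum_le_path_length[of "\<lambda>i. if i = 0 then 0 else 1" 1 g]
  by (simp add: pathstart_def pathfinish_def dist_commute)

lemma dist_le_geodist:
  fixes x y :: "'a::real_normed_vector"
  shows "ereal (dist x y) \<le> geodist A x y"
  unfolding geodist_def
proof (rule INF_greatest)
  fix g :: "real \<Rightarrow> 'a"
  assume "g \<in> {g. rectifiable_path g \<and> path_image g \<subseteq> A \<and> pathstart g = x \<and> pathfinish g = y}"
  then show "ereal (dist x y) \<le> path_length g" using dist_le_path_length[of g] by simp
qed

lemma path_length_lipschitz_le:
  assumes "L-lipschitz_on {0..1} g"
  shows "path_length g \<le> ereal L"
proof (rule path_length_le)
  fix n and t :: "nat \<Rightarrow> real"
  assume t: "t 0 = 0" "t n = 1" "\<And>i. i < n \<Longrightarrow> t i \<le> t (Suc i)"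
  have "(\<Sum>i<n. dist (g (t (Suc i))) (g (t i))) \<le> (\<Sum>i<n. L * (t (Suc i) - t i))"
  proof (rule sum_mono)
    fix i assume "i \<in> {..<n}"
    then have i: "i < n" by simp
    have "dist (g (t (Suc i))) (g (t i)) \<le> L * dist (t (Suc i)) (t i)"
      using i by (intro lipschitz_onD[OF assms] partition_in_unit_interval[OF t]) auto
    then show "dist (g (t (Suc i))) (g (t i)) \<le> L * (t (Suc i) - t i)"
      using t(3)[OF i] by (simp add: dist_real_def)
  qed
  also have "\<dots> = L * (t n - t 0)" by (simp only: sum_distrib_left[symmetric] sum_lessThan_telescope)
  finally show "ereal (\<Sum>i<n. dist (g (t (Suc i))) (g (t i))) \<le> ereal L" using t by simp
qed

lemma path_length_comp_le:
  assumes "\<And>x y. dist (f x) (f y) \<le> C * dist x y" "path_length g \<le> ereal L" "0 \<le> C"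
  shows "path_length (f \<circ> g) \<le> ereal (C * L)"
proof (rule path_length_le)
  fix n and t :: "nat \<Rightarrow> real"
  assume t: "t 0 = 0" "t n = 1" "\<And>i. i < n \<Longrightarrow> t i \<le> t (Suc i)"
  have "(\<Sum>i<n. dist ((f \<circ> g) (t (Suc i))) ((f \<circ> g) (t i))) \<le> (\<Sum>i<n. C * dist (g (t (Suc i))) (g (t i)))"
    using assms(1) by (intro sum_mono) simp
  also have "\<dots> = C * (\<Sum>i<n. dist (g (t (Suc i))) (g (t i)))" by (simp add: sum_distrib_left)
  also have "\<dots> \<le> C * L"
    using order_trans[OF sum_le_path_length[OF t] assms(2)] assms(3) by (intro mult_left_mono) auto
  finally show "ereal (\<Sum>i<n. dist ((f \<circ> g) (t (Suc i))) ((f \<circ> g) (t i))) \<le> ereal (C * L)" by simp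
qed

section \<open>Joining points by Lipschitz curves\<close>

text \<open>A stand-in for a path of length at most \<open>L\<close>, with controlled speed: the
  constants add under concatenation, and the condition is stable under pointwise limits. On a
  compact \<open>A\<close> it is equivalent to \<open>geodist A x y \<le> ereal L\<close>.\<close>

definition lipschitz_joined :: "'a::metric_space set \<Rightarrow> real \<Rightarrow> 'a \<Rightarrow> 'a \<Rightarrow> bool" where
  "lipschitz_joined A L x y \<longleftrightarrow>
     (\<exists>g :: real \<Rightarrow> 'a. L-lipschitz_on {0..1} g \<and> g ` {0..1} \<subseteq> A \<and> g 0 = x \<and> g 1 = y)"

lemma lipschitz_joinedE:
  fixes x y :: "'a::metric_space"
  assumes "lipschitz_joined A L x y"
  obtains g :: "real \<Rightarrow> 'a" where "L-lipschitz_on {0..1} g" "g ` {0..1} \<subseteq> A" "g 0 = x" "g 1 = y"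
  using assms unfolding lipschitz_joined_def by blast

lemma lipschitz_joined_refl: "x \<in> A \<Longrightarrow> lipschitz_joined A 0 x x"
  unfolding lipschitz_joined_def by (rule exI[of _ "\<lambda>_. x"]) (auto intro: lipschitz_on_constant)

lemma lipschitz_joined_segment:
  fixes f :: "real \<Rightarrow> 'a::metric_space"
  assumes "M-lipschitz_on {0..h} f" "f ` {0..h} \<subseteq> A" "0 \<le> h"
  shows "lipschitz_joined A (M * h) (f 0) (f h)"
proof -
  have im: "(\<lambda>t. h * t) ` {0..1} \<subseteq> {0..h}" using assms(3) by (auto simp: mult_left_le)
  have "h-lipschitz_on {0..1} (\<lambda>t::real. h * t)"
    using assms(3) by (intro lipschitz_onI) (auto simp: dist_real_def abs_mult right_diff_distrib[symmetric])
  then have "(M * h)-lipschitz_on {0..1} (f \<circ> (\<lambda>t. h * t))"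
    using lipschitz_on_subset[OF assms(1) im] by (intro lipschitz_on_compose)
  then show ?thesis
    unfolding lipschitz_joined_def using im assms(2)
    by (intro exI[of _ "f \<circ> (\<lambda>t. h * t)"]) auto
qed

lemma lipschitz_joined_sym:
  fixes x y :: "'a::metric_space"
  assumes "lipschitz_joined A L x y"
  shows "lipschitz_joined A L y x"
proof -
  obtain g :: "real \<Rightarrow> 'a" where g: "L-lipschitz_on {0..1} g" "g ` {0..1} \<subseteq> A" "g 0 = x" "g 1 = y"
    using lipschitz_joinedE[OF assms] .
  have im: "(\<lambda>t::real. 1 - t) ` {0..1} \<subseteq> {0..1}" by auto
  have "1-lipschitz_on {0..1} (\<lambda>t::real. 1 - t)" by (intro lipschitz_onI) (auto simp: dist_real_def)
  then have "(L * 1)-lipschitz_on {0..1} (g \<circ> (\<lambda>t. 1 - t))"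
    using lipschitz_on_subset[OF g(1) im] by (intro lipschitz_on_compose)
  then show ?thesis
    unfolding lipschitz_joined_def using im g by (intro exI[of _ "g \<circ> (\<lambda>t. 1 - t)"]) auto
qed

lemma lipschitz_joined_trans:
  fixes x y z :: "'a::metric_space"
  assumes "lipschitz_joined A L x y" "lipschitz_joined A M y z"
  shows "lipschitz_joined A (L + M) x z"
proof -
  obtain g :: "real \<Rightarrow> 'a" where g: "L-lipschitz_on {0..1} g" "g ` {0..1} \<subseteq> A" "g 0 = x" "g 1 = y"
    using lipschitz_joinedE[OF assms(1)] .
  obtain k :: "real \<Rightarrow> 'a" where k: "M-lipschitz_on {0..1} k" "k ` {0..1} \<subseteq> A" "k 0 = y" "k 1 = z"
    using lipschitz_joinedE[OF assms(2)] .
  have L: "0 \<le> L" and M: "0 \<le> M" using g k by (auto dest: lipschitz_on_nonneg)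
  \<comment> \<open>The general case runs both pieces at unit speed on intervals of lengths
    \<open>L\<close> and \<open>M\<close>, which divides by these; a piece of length zero is
    constant and is dropped.\<close>
  consider "L = 0" | "M = 0" | "L > 0" "M > 0" using L M by linarith
  then show ?thesis
  proof cases
    case 1
    then have "x = y" using lipschitz_onD[OF g(1), of 0 1] g by simp
    then show ?thesis using assms(2) 1 by simp
  next
    case 2
    then have "y = z" using lipschitz_onD[OF k(1), of 0 1] k by simp
    then show ?thesis using assms(1) 2 by simp
  next
    case 3
    define g' where "g' = g \<circ> (\<lambda>t. t / L)"
    define k' where "k' = k \<circ> (\<lambda>t. (t - L) / M)"
    define j where "j = (\<lambda>t. if t \<le> L then g' t else k' t)"
    have img: "(\<lambda>t. t / L) ` {0..L} \<subseteq> {0..1}" using 3 by auto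
    have imk: "(\<lambda>t. (t - L) / M) ` {L..L+M} \<subseteq> {0..1}" using 3 by auto
    have "(1 / L)-lipschitz_on {0..L} (\<lambda>t. t / L)"
      using 3 by (intro lipschitz_onI) (auto simp: dist_real_def diff_divide_distrib[symmetric])
    then have "(L * (1 / L))-lipschitz_on {0..L} g'"
      unfolding g'_def using lipschitz_on_subset[OF g(1) img] by (intro lipschitz_on_compose)
    then have lg: "1-lipschitz_on {0..L} g'" using 3 by simp
    have "(1 / M)-lipschitz_on {L..L+M} (\<lambda>t. (t - L) / M)"
      using 3 by (intro lipschitz_onI) (auto simp: dist_real_def diff_divide_distrib[symmetric])
    then have "(M * (1 / M))-lipschitz_on {L..L+M} k'"
      unfolding k'_def using lipschitz_on_subset[OF k(1) imk] by (intro lipschitz_on_compose)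
    then have lk: "1-lipschitz_on {L..L+M} k'" using 3 by simp
    have "g' L = k' L" using 3 g k by (simp add: g'_def k'_def)
    then have lj: "1-lipschitz_on {0..L+M} j" unfolding j_def by (rule lipschitz_on_concat[OF lg lk])
    have ij: "j ` {0..L+M} \<subseteq> A"
    proof
      fix w assume "w \<in> j ` {0..L+M}"
      then obtain t where t: "t \<in> {0..L+M}" "w = j t" by blast
      show "w \<in> A"
      proof (cases "t \<le> L")
        case True
        then have "t / L \<in> {0..1}" using 3 t by simp
        then show ?thesis using g(2) True t by (auto simp: j_def g'_def)
      next
        case False
        then have "(t - L) / M \<in> {0..1}" using 3 t by simp
        then show ?thesis using k(2) False t by (auto simp: j_def k'_def)
      qed
    qed
    have "lipschitz_joined A (1 * (L + M)) (j 0) (j (L + M))"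
      using 3 by (intro lipschitz_joined_segment[OF lj ij]) simp
    then show ?thesis using 3 g k by (simp add: j_def g'_def k'_def)
  qed
qed

lemma geodist_le_of_lipschitz_joined:
  fixes x y :: "'a::real_normed_vector"
  assumes "lipschitz_joined A L x y"
  shows "geodist A x y \<le> ereal L"
proof -
  obtain g :: "real \<Rightarrow> 'a" where g: "L-lipschitz_on {0..1} g" "g ` {0..1} \<subseteq> A" "g 0 = x" "g 1 = y"
    using lipschitz_joinedE[OF assms] .
  have len: "path_length g \<le> ereal L" by (rule path_length_lipschitz_le[OF g(1)])
  then have "rectifiable_path g"
    using lipschitz_on_continuous_on[OF g(1)] by (auto simp: rectifiable_path_def path_def)
  then have "geodist A x y \<le> path_length g"
    unfolding geodist_def
    by (intro INF_lower) (use g in \<open>auto simp: path_image_def pathstart_def pathfinish_def\<close>)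
  then show ?thesis using len by (rule order_trans)
qed

text \<open>Each step that does not reach the end point is chosen, by the intermediate value theorem,
  to have chord exactly \<open>d\<close>; there are fewer than \<open>n\<close> of these.\<close>

lemma path_subdivision:
  fixes g :: "real \<Rightarrow> 'a::real_normed_vector"
  assumes g: "path g" and len: "path_length g < ereal (real n * d)" and d: "0 < d"
  shows "\<exists>t. t 0 = 0 \<and> t n = (1::real) \<and> (\<forall>i\<le>n. t i \<in> {0..1}) \<and> (\<forall>i<n. dist (g (t i)) (g (t (Suc i))) \<le> d)"
proof -
  have cont: "continuous_on {0..1} g" using g by (simp add: path_def)
  \<comment> \<open>The last alternative is the invariant: either the end has been reached or every
    chord so far has full length \<open>d\<close>.\<close>
  have "\<exists>t. t 0 = 0 \<and> (\<forall>i\<le>m. t i \<in> {0..1::real}) \<and> (\<forall>i<m. t i \<le> t (Suc i) \<and> dist (g (t i)) (g (t (Suc i))) \<le> d) \<and>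
      (t m = 1 \<or> (\<forall>i<m. dist (g (t i)) (g (t (Suc i))) = d))" for m
  proof (induction m)
    case 0
    show ?case by (rule exI[of _ "\<lambda>_. 0"]) simp
  next
    case (Suc m)
    then obtain t where t: "t 0 = 0" "\<forall>i\<le>m. t i \<in> {0..1::real}"
      "\<forall>i<m. t i \<le> t (Suc i) \<and> dist (g (t i)) (g (t (Suc i))) \<le> d"
      "t m = 1 \<or> (\<forall>i<m. dist (g (t i)) (g (t (Suc i))) = d)" by blast
    have tm: "t m \<in> {0..1}" using t(2) by simp
    obtain s where s: "s \<in> {t m..1}" "dist (g (t m)) (g s) \<le> d" "s = 1 \<or> dist (g (t m)) (g s) = d \<and> t m \<noteq> 1"
    proof (cases "dist (g (t m)) (g 1) \<le> d")
      case True
      then show ?thesis using that[of 1] tm by simp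
    next
      case False
      have "continuous_on {t m..1} (\<lambda>s. dist (g (t m)) (g s))"
        by (intro continuous_intros continuous_on_subset[OF cont]) (use tm in auto)
      then obtain s where "t m \<le> s" "s \<le> 1" "dist (g (t m)) (g s) = d"
        using IVT'[of "\<lambda>s. dist (g (t m)) (g s)" "t m" d 1] False d tm by auto
      moreover have "t m \<noteq> 1" using False d by auto
      ultimately show ?thesis using that[of s] by simp
    qed
    define t' where "t' = t(Suc m := s)"
    have "t' i = t i" if "i \<le> m" for i using that by (simp add: t'_def)
    moreover have "t' (Suc m) = s" by (simp add: t'_def)
    ultimately have "t' 0 = 0 \<and> (\<forall>i\<le>Suc m. t' i \<in> {0..1}) \<and>
      (\<forall>i<Suc m. t' i \<le> t' (Suc i) \<and> dist (g (t' i)) (g (t' (Suc i))) \<le> d) \<and>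
      (t' (Suc m) = 1 \<or> (\<forall>i<Suc m. dist (g (t' i)) (g (t' (Suc i))) = d))"
      using t s tm by (auto simp: le_Suc_eq less_Suc_eq)
    then show ?case by blast
  qed
  from this[of n] obtain t where t: "t 0 = 0" "\<forall>i\<le>n. t i \<in> {0..1::real}"
      "\<forall>i<n. t i \<le> t (Suc i) \<and> dist (g (t i)) (g (t (Suc i))) \<le> d"
      "t n = 1 \<or> (\<forall>i<n. dist (g (t i)) (g (t (Suc i))) = d)" by blast
  have "t n = 1"
  proof (rule ccontr)
    assume "t n \<noteq> 1"
    then have eq: "\<forall>i<n. dist (g (t i)) (g (t (Suc i))) = d" using t(4) by blast
    \<comment> \<open>One more node at 1 completes the nodes to a partition of the unit interval;
      its \<open>n\<close> full chords then contradict \<open>len\<close>.\<close>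
    define t' where "t' = t(Suc n := 1)"
    have t'_le: "t' i = t i" if "i \<le> n" for i using that by (simp add: t'_def)
    have "ereal (\<Sum>i<Suc n. dist (g (t' (Suc i))) (g (t' i))) \<le> path_length g"
      by (rule sum_le_path_length) (use t in \<open>auto simp: t'_def less_Suc_eq\<close>)
    moreover have "(\<Sum>i<n. dist (g (t' (Suc i))) (g (t' i))) = (\<Sum>i<n. d)"
      using eq by (intro sum.cong) (auto simp: t'_le dist_commute)
    then have "real n * d \<le> (\<Sum>i<Suc n. dist (g (t' (Suc i))) (g (t' i)))" by simp
    ultimately have "ereal (real n * d) \<le> path_length g" by (meson ereal_less_eq(3) order_trans)
    then show False using len by simp
  qed
  then show ?thesis using t by blast
qed

section \<open>Shortest paths in compact sets\<close>

text \<open>Step functions along the chains need not be continuous, but they are Lipschitz up to an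
  error. Such conditions are closed for pointwise convergence, so compactness of the product yields
  one map satisfying all of them, and the error disappears.\<close>

lemma lipschitz_joined_of_chains:
  fixes x y :: "'a::metric_space"
  assumes A: "compact A" and L: "0 \<le> L"
    and chain: "\<And>m. 0 < m \<Longrightarrow> \<exists>p. p 0 = x \<and> p m = y \<and> (\<forall>i\<le>m. p i \<in> A) \<and>
      (\<forall>i<m. dist (p i) (p (Suc i)) \<le> (L + 1 / real m) / real m)"
  shows "lipschitz_joined A L x y"
proof -
  \<comment> \<open>The first error term is the slack in the chain bound, the second comes from
    rounding parameters to the grid of mesh \<open>1 / Suc n\<close>.\<close>
  define b where "b n r = (L + 1 / real (Suc n)) * (r + 1 / real (Suc n))" for n r
  define C where "C n = {f :: real \<Rightarrow> 'a. f 0 = x \<and> f 1 = y \<and> (\<forall>u\<in>{0..1}. \<forall>v\<in>{0..1}. dist (f u) (f v) \<le> b n \<bar>u - v\<bar>)}" for n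
  define P where "P = (\<Pi>\<^sub>E u\<in>(UNIV :: real set). A)"
  have "compactin (product_topology (\<lambda>_. euclidean) UNIV) P"
    unfolding P_def compactin_PiE using A by simp
  then have P: "compact P" by (simp add: euclidean_product_topology)
  have clC: "closed (C n)" for n
  proof -
    have eval: "continuous_on UNIV (\<lambda>f :: real \<Rightarrow> 'a. f u)" for u by simp
    have "C n = {f. f 0 = x} \<inter> {f. f 1 = y} \<inter> (\<Inter>u\<in>{0..1}. \<Inter>v\<in>{0..1}. {f. dist (f u) (f v) \<le> b n \<bar>u - v\<bar>})"
      by (auto simp: C_def)
    moreover have "closed {f :: real \<Rightarrow> 'a. f 0 = x}" "closed {f :: real \<Rightarrow> 'a. f 1 = y}"
      by (intro closed_Collect_eq eval continuous_on_const)+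
    moreover have "closed {f :: real \<Rightarrow> 'a. dist (f u) (f v) \<le> b n \<bar>u - v\<bar>}" for u v
      by (intro closed_Collect_le continuous_on_dist eval continuous_on_const)
    ultimately show ?thesis by (simp add: closed_Int closed_INT)
  qed
  have b_mono: "b n r \<le> b m r" if "m \<le> n" "0 \<le> r" for m n r
    unfolding b_def using that L by (intro mult_mono add_left_mono) (auto simp: field_simps)
  have C_mono: "C n \<subseteq> C m" if "m \<le> n" for m n
  proof
    fix f assume f: "f \<in> C n"
    have "dist (f u) (f v) \<le> b m \<bar>u - v\<bar>" if "u \<in> {0..1}" "v \<in> {0..1}" for u v
    proof -
      have "dist (f u) (f v) \<le> b n \<bar>u - v\<bar>" using f that unfolding C_def by blast
      then show ?thesis using b_mono[OF \<open>m \<le> n\<close>, of "\<bar>u - v\<bar>"] by linarith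
    qed
    then show "f \<in> C m" using f unfolding C_def by simp
  qed
  have C_ne: "P \<inter> C n \<noteq> {}" for n
  proof -
    let ?m = "Suc n"
    define d where "d = (L + 1 / real ?m) / real ?m"
    have d: "0 \<le> d" using L by (simp add: d_def)
    obtain p where p: "p 0 = x" "p ?m = y" "\<And>i. i \<le> ?m \<Longrightarrow> p i \<in> A"
      "\<And>i. i < ?m \<Longrightarrow> dist (p i) (p (Suc i)) \<le> d"
      using chain[of ?m] unfolding d_def by auto
    have pd: "dist (p i) (p (i + j)) \<le> real j * d" if "i + j \<le> ?m" for i j
      using that
    proof (induction j)
      case (Suc j)
      have "dist (p i) (p (i + Suc j)) \<le> dist (p i) (p (i + j)) + dist (p (i + j)) (p (Suc (i + j)))"
        using dist_triangle by simp
      also have "\<dots> \<le> real j * d + d" using Suc p(4)[of "i + j"] by simp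
      finally show ?case by (simp add: algebra_simps)
    qed simp
    define k where "k u = nat \<lfloor>u * real ?m\<rfloor>" for u
    \<comment> \<open>The value \<open>x\<close> outside the unit interval only serves to keep
      \<open>f\<close> in the product \<open>P\<close>, whose index set is all of the reals.\<close>
    define f where "f u = (if u \<in> {0..1} then p (k u) else x)" for u :: real
    have km: "k u \<le> ?m" if "u \<in> {0..1}" for u
    proof -
      have "u * real ?m \<le> real ?m" using that by (simp add: mult_left_le_one_le)
      then have "\<lfloor>u * real ?m\<rfloor> \<le> int ?m" by (metis floor_mono floor_of_nat)
      then show ?thesis by (simp only: k_def nat_le_iff)
    qed
    have kb: "real (k u) \<le> u * real ?m" "u * real ?m < real (k u) + 1" if "u \<in> {0..1}" for u
    proof -
      have "0 \<le> u * real ?m" using that by simp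
      then have "real (k u) = of_int \<lfloor>u * real ?m\<rfloor>" by (simp add: k_def)
      then show "real (k u) \<le> u * real ?m" "u * real ?m < real (k u) + 1" by linarith+
    qed
    have main: "dist (f u) (f v) \<le> b n \<bar>u - v\<bar>" if uv: "u \<in> {0..1}" "v \<in> {0..1}" "u \<le> v" for u v
    proof -
      have kk: "k u \<le> k v"
        unfolding k_def using uv by (intro nat_mono floor_mono mult_right_mono) auto
      have "dist (f u) (f v) = dist (p (k u)) (p (k u + (k v - k u)))"
        using uv kk by (simp add: f_def)
      also have "\<dots> \<le> real (k v - k u) * d" using kk km[OF uv(2)] by (intro pd) simp
      also have "\<dots> \<le> ((v - u) * real ?m + 1) * d"
        using kb[OF uv(1)] kb[OF uv(2)] kk d by (intro mult_right_mono) (auto simp: of_nat_diff algebra_simps)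
      also have "\<dots> = b n \<bar>u - v\<bar>" using uv(3) by (simp add: d_def b_def field_simps)
      finally show ?thesis .
    qed
    have "dist (f u) (f v) \<le> b n \<bar>u - v\<bar>" if "u \<in> {0..1}" "v \<in> {0..1}" for u v
      using main[OF that] main[OF that(2,1)] by (cases "u \<le> v") (auto simp: dist_commute abs_minus_commute)
    moreover have "k 1 = ?m" unfolding k_def mult_1 floor_of_nat by (rule nat_int)
    then have "f 0 = x" "f 1 = y" using p by (simp_all add: f_def k_def[of 0])
    ultimately have "f \<in> C n" by (simp add: C_def)
    moreover have "f \<in> P" using p(1) p(3)[of 0] p(3)[OF km] by (auto simp: P_def f_def)
    ultimately show ?thesis by blast
  qed
  have "P \<inter> (\<Inter>n. C n) \<noteq> {}"
  proof (rule compact_imp_fip_image[OF P])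
    fix N :: "nat set" assume N: "finite N"
    then have "n \<le> Max (insert 0 N)" if "n \<in> N" for n using that by simp
    then have "C (Max (insert 0 N)) \<subseteq> (\<Inter>n\<in>N. C n)" by (intro INT_greatest C_mono)
    then show "P \<inter> (\<Inter>n\<in>N. C n) \<noteq> {}" using C_ne[of "Max (insert 0 N)"] by blast
  qed (rule clC)
  then obtain f where f: "f \<in> P" "\<And>n. f \<in> C n" by blast
  have "dist (f u) (f v) \<le> L * dist u v" if "u \<in> {0..1}" "v \<in> {0..1}" for u v
  proof (rule LIMSEQ_le_const)
    show "(\<lambda>n. b n \<bar>u - v\<bar>) \<longlonglongrightarrow> L * dist u v"
    proof -
      have "(\<lambda>n. b n \<bar>u - v\<bar>) \<longlonglongrightarrow> (L + 0) * (\<bar>u - v\<bar> + 0)"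
        unfolding b_def
        by (intro tendsto_mult tendsto_add tendsto_const LIMSEQ_inverse_real_of_nat[unfolded inverse_eq_divide])
      then show ?thesis by (simp add: dist_real_def)
    qed
    show "\<exists>N. \<forall>n\<ge>N. dist (f u) (f v) \<le> b n \<bar>u - v\<bar>" using f(2) that unfolding C_def by blast
  qed
  then have "L-lipschitz_on {0..1} f" using L by (intro lipschitz_onI) auto
  moreover have "f 0 = x" "f 1 = y" using f(2)[of 0] by (auto simp: C_def)
  moreover have "f ` {0..1} \<subseteq> A" using f(1) by (auto simp: P_def)
  ultimately show ?thesis unfolding lipschitz_joined_def by blast
qed

text \<open>A path in \<open>A\<close> shorter than \<open>L + 1 / m\<close> can be cut into
  \<open>m\<close> chords of equal upper bound; its nodes are the chains required above.\<close>

lemma lipschitz_joined_of_geodist_le: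
  fixes x y :: "'a::real_normed_vector"
  assumes A: "compact A" and le: "geodist A x y \<le> ereal L"
  shows "lipschitz_joined A L x y"
proof (rule lipschitz_joined_of_chains[OF A])
  have "ereal (dist x y) \<le> ereal L" using dist_le_geodist le by (rule order_trans)
  then show "0 \<le> L" using order_trans[OF zero_le_dist[of x y]] by simp
  fix m :: nat assume m: "0 < m"
  have "geodist A x y < ereal (L + 1 / real m)" using m by (intro le_less_trans[OF le]) simp
  then obtain g where g: "rectifiable_path g" "path_image g \<subseteq> A" "pathstart g = x" "pathfinish g = y"
    "path_length g < ereal (L + 1 / real m)"
    unfolding geodist_def INF_less_iff by blast
  have pos: "0 < L + 1 / real m" using m \<open>0 \<le> L\<close> by (simp add: add_nonneg_pos)
  have "\<exists>t. t 0 = 0 \<and> t m = (1::real) \<and> (\<forall>i\<le>m. t i \<in> {0..1}) \<and>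
      (\<forall>i<m. dist (g (t i)) (g (t (Suc i))) \<le> (L + 1 / real m) / real m)"
    using g m pos by (intro path_subdivision) (auto simp: rectifiable_path_def)
  then obtain t where t: "t 0 = 0" "t m = (1::real)" "\<forall>i\<le>m. t i \<in> {0..1}"
      "\<forall>i<m. dist (g (t i)) (g (t (Suc i))) \<le> (L + 1 / real m) / real m" by blast
  then show "\<exists>p. p 0 = x \<and> p m = y \<and> (\<forall>i\<le>m. p i \<in> A) \<and>
      (\<forall>i<m. dist (p i) (p (Suc i)) \<le> (L + 1 / real m) / real m)"
    using g by (intro exI[of _ "\<lambda>i. g (t i)"]) (auto simp: pathstart_def pathfinish_def path_image_def)
qed

lemma minimal_path_exists:
  fixes x y :: "'a::real_normed_vector"
  assumes A: "compact A" and fin: "geodist A x y < \<infinity>"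
  obtains g where "path g" "path_image g \<subseteq> A" "pathstart g = x" "pathfinish g = y"
    "path_length g = geodist A x y"
proof -
  have "ereal (dist x y) \<le> geodist A x y" by (rule dist_le_geodist)
  then obtain L where L: "geodist A x y = ereal L" using fin by (cases "geodist A x y") auto
  then have "lipschitz_joined A L x y" using A by (intro lipschitz_joined_of_geodist_le) auto
  then obtain g :: "real \<Rightarrow> 'a" where g: "L-lipschitz_on {0..1} g" "g ` {0..1} \<subseteq> A" "g 0 = x" "g 1 = y"
    by (rule lipschitz_joinedE)
  have len: "path_length g \<le> ereal L" by (rule path_length_lipschitz_le[OF g(1)])
  have p: "path g" using lipschitz_on_continuous_on[OF g(1)] by (simp add: path_def)
  have "geodist A x y \<le> path_length g"
    unfolding geodist_def
    by (intro INF_lower)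
      (use g len p in \<open>auto simp: rectifiable_path_def path_image_def pathstart_def pathfinish_def\<close>)
  then show ?thesis
    using that[of g] p g len L by (auto simp: path_image_def pathstart_def pathfinish_def)
qed

section \<open>Retraction onto the axis\<close>

lemma RK_le_Rmax:
  fixes K :: "'a::euclidean_space set"
  assumes "K \<noteq> {}" "bounded (- K)" "x \<notin> K"
  shows "RK K x \<le> Rmax K"
proof -
  obtain k where k: "k \<in> K" using assms(1) by blast
  obtain B where B: "\<And>y. y \<in> - K \<Longrightarrow> dist k y \<le> B"
    using assms(2) bounded_any_center[of "- K" k] by blast
  have "bdd_above (RK K ` (- K))"
  proof (rule bdd_aboveI2)
    fix y assume "y \<in> - K"
    then show "RK K y \<le> B" using B[of y] infdist_le[OF k, of y] by (simp add: RK_def dist_commute)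
  qed
  then show ?thesis unfolding Rmax_def using assms(3) by (intro cSUP_upper) auto
qed

lemma not_in_offset_iff: "x \<in> - offset K a \<longleftrightarrow> a < RK K x"
  by (auto simp: offset_def RK_def)

lemma not_mem_of_RK_pos: "0 < RK K x \<Longrightarrow> x \<notin> K"
  by (auto simp: RK_def)

lemma lambda_axis_subset:
  assumes "0 < lam"
  shows "lambda_axis lam a K \<subseteq> - offset K a"
  using FK_eq_0[of _ "offset K a"] assms by (force simp: lambda_axis_def)

lemma lambda_axis_iff:
  fixes K :: "'a::euclidean_space set"
  assumes "closed K" "K \<noteq> {}" "0 \<le> a" "a < RK K x"
  shows "x \<in> lambda_axis lam a K \<longleftrightarrow> lam \<le> (1 - a / RK K x) * FK K x"
  using FK_offset[OF assms] by (simp add: lambda_axis_def)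

lemma compact_lambda_axis:
  fixes K :: "'a::euclidean_space set"
  assumes "K \<noteq> {}" "bounded (- K)" "0 \<le> a" "0 < lam"
  shows "compact (lambda_axis lam a K)"
proof -
  have "bounded (lambda_axis lam a K)"
    using lambda_axis_subset[OF assms(4), of a K] subset_offset[OF assms(3), of K]
    by (intro bounded_subset[OF assms(2)]) blast
  moreover have "closed (lambda_axis lam a K)"
    unfolding lambda_axis_def
    using subset_offset[OF assms(3), of K] assms(1) by (intro closed_FK_superlevel offset_closed) blast
  ultimately show ?thesis by (simp add: compact_eq_bounded_closed)
qed

lemma FK_nonneg:
  assumes "closed K" "K \<noteq> {}"
  shows "0 \<le> FK K x"
  unfolding FK_eq[OF assms]
  using power_mono[OF norm_foot_le_RK[OF assms, of x], of 2] by simp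

text \<open>By \<open>FK_offset\<close> the axis condition bounds a product from below, and a step
  decreases neither of its factors.\<close>

lemma prox_in_lambda_axis:
  fixes K :: "'a::euclidean_space set"
  assumes K: "closed K" "K \<noteq> {}" and h: "0 \<le> h" "h < 1" and a: "0 \<le> a" "0 < lam"
    and x: "x \<in> lambda_axis lam a K"
  shows "prox K h x \<in> lambda_axis lam a K"
proof -
  have R: "a < RK K x" using lambda_axis_subset[OF a(2)] x not_in_offset_iff by blast
  have RR: "RK K x \<le> RK K (prox K h x)" by (rule prox_RK_mono[OF K h])
  have "lam \<le> (1 - a / RK K x) * FK K x" using x lambda_axis_iff[OF K a(1) R] by blast
  also have "\<dots> \<le> (1 - a / RK K (prox K h x)) * FK K (prox K h x)"
  proof (intro mult_mono diff_left_mono prox_FK_mono K h FK_nonneg)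
    show "a / RK K (prox K h x) \<le> a / RK K x" using R RR a by (intro divide_left_mono) auto
    show "0 \<le> 1 - a / RK K (prox K h x)" using R RR a by (simp add: field_simps)
  qed
  finally show ?thesis using lambda_axis_iff[OF K a(1)] R RR by simp
qed

lemma nablaK_ge_of_lt_reach_mu:
  assumes "a < RK K x" "ereal (RK K x) < reach_mu mu a K"
  shows "mu \<le> norm (nablaK K x)"
proof -
  let ?S = "{norm (nablaK K z) | z. RK K z = RK K x}"
  have "\<not> chiK K (RK K x) < mu"
  proof
    assume "chiK K (RK K x) < mu"
    then have "reach_mu mu a K \<le> ereal (RK K x)"
      unfolding reach_mu_def using assms(1) by (intro Inf_lower) auto
    then show False using assms(2) by simp
  qed
  moreover have "norm (nablaK K x) \<in> ?S" by blast
  moreover have "bdd_below ?S" by (intro bdd_belowI[of _ 0]) auto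
  ultimately show ?thesis
    using cInf_lower[of "norm (nablaK K x)" ?S] by (auto simp: chiK_def Let_def split: if_splits)
qed

text \<open>The strict gap \<open>lam < r - a\<close> keeps the square root positive, which makes
  the growth rate off the axis nontrivial.\<close>

lemma mu_tilde_bounds:
  assumes "0 < mu" "mu \<le> 1" "0 < lam" "reach_mu mu a K > ereal (a + lam)"
  shows "0 < mu_tilde mu lam a a K" "mu_tilde mu lam a a K \<le> mu"
proof -
  show "0 < mu_tilde mu lam a a K"
  proof (cases "reach_mu mu a K = \<infinity>")
    case False
    then obtain r where r: "reach_mu mu a K = ereal r"
      using assms(4) by (cases "reach_mu mu a K") auto
    then have "lam < r - a" using assms(4) by simp
    then have "0 \<le> lam / (r - a)" "lam / (r - a) < 1" using assms(3) by auto
    then have "(lam / (r - a))\<^sup>2 < 1" by (simp add: power_less_one_iff)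
    then show ?thesis using r assms(1) by (simp add: mu_tilde_def)
  qed (use assms in \<open>simp add: mu_tilde_def\<close>)
qed (simp add: mu_tilde_def)

text \<open>Below the reach the critical function gives the slope \<open>mu\<close>. From the reach
  \<open>r\<close> on, being off the axis forces \<open>FK K x\<close> to be at most
  \<open>lam / (r - a)\<close> times \<open>RK K x\<close>, and the squares of \<open>FK K x\<close>
  and of the slope sum to that of \<open>RK K x\<close>.\<close>

lemma slope_ge_mu_tilde_off_axis:
  fixes K :: "'a::euclidean_space set"
  assumes K: "closed K" "K \<noteq> {}" and mu: "0 < mu" "mu \<le> 1" and a: "0 \<le> a" "0 < lam"
    and reach: "reach_mu mu a K > ereal (a + lam)"
    and x: "a < RK K x" "x \<notin> lambda_axis lam a K"
  shows "mu_tilde mu lam a a K * RK K x \<le> norm (x - foot K x)"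
proof (cases "ereal (RK K x) < reach_mu mu a K")
  case True
  have R: "0 < RK K x" using x a by simp
  have "mu \<le> norm (x - foot K x) / RK K x"
    using nablaK_ge_of_lt_reach_mu[OF x(1) True] R by (simp add: nablaK_eq[OF K] divide_inverse_commute)
  then have "mu * RK K x \<le> norm (x - foot K x)" using R by (simp add: field_simps)
  moreover have "mu_tilde mu lam a a K * RK K x \<le> mu * RK K x"
    using mu_tilde_bounds(2)[OF mu a(2) reach] R by (intro mult_right_mono) auto
  ultimately show ?thesis by linarith
next
  case False
  then obtain r where r: "reach_mu mu a K = ereal r"
    using reach by (cases "reach_mu mu a K") auto
  let ?R = "RK K x" and ?F = "FK K x"
  define q where "q = lam / (r - a)"
  have rR: "r \<le> ?R" and ra: "lam < r - a" using False reach r by auto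
  have R: "0 < ?R" using x a by simp
  have q: "0 \<le> q" "q < 1" using ra a by (auto simp: q_def)
  have "(1 - a / ?R) * ?F < lam" using x lambda_axis_iff[OF K a(1) x(1)] by (simp add: not_le)
  then have "(?R - a) * ?F < lam * ?R" using R by (simp add: field_simps)
  moreover have "(r - a) * ?F \<le> (?R - a) * ?F" using rR FK_nonneg[OF K] by (intro mult_right_mono) auto
  ultimately have "(r - a) * ?F \<le> lam * ?R" by linarith
  then have "?F \<le> q * ?R" using ra a by (simp add: q_def field_simps)
  then have "?F\<^sup>2 \<le> (q * ?R)\<^sup>2" by (intro power_mono FK_nonneg[OF K])
  moreover have "?F\<^sup>2 = ?R\<^sup>2 - (norm (x - foot K x))\<^sup>2"
    unfolding FK_eq[OF K] using power_mono[OF norm_foot_le_RK[OF K, of x], of 2] by simp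
  moreover have "(sqrt (1 - q\<^sup>2) * ?R)\<^sup>2 = ?R\<^sup>2 - (q * ?R)\<^sup>2"
    using q by (simp add: power_mult_distrib algebra_simps power_le_one)
  ultimately have "(sqrt (1 - q\<^sup>2) * ?R)\<^sup>2 \<le> (norm (x - foot K x))\<^sup>2" by linarith
  then have "sqrt (1 - q\<^sup>2) * ?R \<le> norm (x - foot K x)" by (rule power2_le_imp_le) simp
  moreover have "mu_tilde mu lam a a K \<le> sqrt (1 - q\<^sup>2)" using r by (simp add: mu_tilde_def q_def)
  then have "mu_tilde mu lam a a K * ?R \<le> sqrt (1 - q\<^sup>2) * ?R" using R by (intro mult_right_mono) auto
  ultimately show ?thesis by linarith
qed

text \<open>An orbit still off the axis after \<open>N\<close> steps has multiplied its squared
  distance by a fixed factor at each of them; as this cannot exceed the square of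
  \<open>Rmax K\<close>, the start would lie in the offset.\<close>

lemma prox_iterate_in_lambda_axis:
  fixes K :: "'a::euclidean_space set"
  assumes K: "closed K" "K \<noteq> {}" "bounded (- K)" and h: "0 \<le> h" "h < 1" and a: "0 \<le> a" "0 < lam"
    and m: "0 < m" "m \<le> 1"
    and slope: "\<And>y. a < RK K y \<Longrightarrow> y \<notin> lambda_axis lam a K \<Longrightarrow> m * RK K y \<le> norm (y - foot K y)"
    and N: "(1 - h * (2 - h) * m\<^sup>2) ^ N * (Rmax K)\<^sup>2 \<le> a\<^sup>2"
    and x: "a < RK K x"
  shows "(prox K h ^^ N) x \<in> lambda_axis lam a K"
proof (rule ccontr)
  let ?A = "lambda_axis lam a K" and ?x = "\<lambda>i. (prox K h ^^ i) x"
  define z where "z = h * (2 - h) * m\<^sup>2"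
  have hh: "0 \<le> h * (2 - h)" "h * (2 - h) \<le> 1"
  proof -
    show "0 \<le> h * (2 - h)" using h by simp
    have "1 - h * (2 - h) = (1 - h)\<^sup>2" by (simp add: power2_eq_square algebra_simps)
    then show "h * (2 - h) \<le> 1" using zero_le_power2[of "1 - h"] by linarith
  qed
  have z: "0 \<le> z" "z \<le> 1"
    unfolding z_def using hh m by (auto intro!: mult_le_one power_le_one)
  assume off: "?x N \<notin> ?A"
  \<comment> \<open>Invariance of the axis, read backwards: an iterate off the axis has only
    predecessors off the axis.\<close>
  have offi: "?x (N - j) \<notin> ?A" for j
  proof (induction j)
    case (Suc j)
    show ?case
    proof (cases "j < N")
      case True
      then have "?x (N - j) = prox K h (?x (N - Suc j))" by (metis Suc_diff_Suc funpow.simps(2) o_apply)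
      then show ?thesis using prox_in_lambda_axis[OF K(1,2) h a] Suc by metis
    qed (use Suc in simp)
  qed (use off in simp)
  have Ra: "a < RK K (?x i)" for i
    by (induction i) (use x prox_RK_mono[OF K(1,2) h] less_le_trans in auto)
  have "(RK K x)\<^sup>2 \<le> (1 - z) ^ i * (RK K (?x i))\<^sup>2" if "i \<le> N" for i
    using that
  proof (induction i)
    case (Suc i)
    let ?y = "?x (Suc i)"
    have y: "?y = prox K h (?x i)" by simp
    have "?y \<notin> ?A" using offi[of "N - Suc i"] Suc.prems by simp
    then have "m * RK K ?y \<le> norm (?y - foot K ?y)" by (intro slope Ra)
    then have "(m * RK K ?y)\<^sup>2 \<le> (norm (?y - foot K ?y))\<^sup>2"
      using m RK_nonneg[of K ?y] by (intro power_mono) simp_all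
    then have "z * (RK K ?y)\<^sup>2 \<le> h * (2 - h) * (norm (?y - foot K ?y))\<^sup>2"
      unfolding z_def using mult_left_mono[OF _ hh(1)] by (simp add: power_mult_distrib mult.assoc)
    then have "(RK K (?x i))\<^sup>2 \<le> (1 - z) * (RK K ?y)\<^sup>2"
      using prox_RK_growth[OF K(1,2) h, of "?x i"] unfolding y[symmetric] left_diff_distrib by linarith
    then have "(1 - z) ^ i * (RK K (?x i))\<^sup>2 \<le> (1 - z) ^ i * ((1 - z) * (RK K ?y)\<^sup>2)"
      using z by (intro mult_left_mono) auto
    then show ?case using Suc by (simp add: mult.assoc mult.left_commute)
  qed simp
  from this[of N] have "(RK K x)\<^sup>2 \<le> (1 - z) ^ N * (RK K (?x N))\<^sup>2" by simp
  also have "\<dots> \<le> (1 - z) ^ N * (Rmax K)\<^sup>2"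
  proof (intro mult_left_mono power_mono RK_nonneg)
    have "0 < RK K (?x N)" using Ra[of N] a by linarith
    then show "RK K (?x N) \<le> Rmax K" by (intro RK_le_Rmax K not_mem_of_RK_pos)
  qed (use z in auto)
  also have "\<dots> \<le> a\<^sup>2" using N by (simp add: z_def)
  finally have "RK K x \<le> a" using a(1) by (rule power2_le_imp_le)
  then show False using x by simp
qed

text \<open>Consecutive iterates are joined by varying the step size from 0 to \<open>h\<close>;
  every intermediate point is itself a proximal image of an axis point, so it stays in the
  axis.\<close>

lemma lipschitz_joined_prox_iterate:
  fixes K :: "'a::euclidean_space set"
  assumes K: "closed K" "K \<noteq> {}" "bounded (- K)" and h: "0 \<le> h" "h < 1" and a: "0 \<le> a" "0 < lam"
    and x: "x \<in> lambda_axis lam a K"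
  shows "(prox K h ^^ N) x \<in> lambda_axis lam a K \<and>
    lipschitz_joined (lambda_axis lam a K) (real N * (Rmax K / (1 - h) * h)) x ((prox K h ^^ N) x)"
proof (induction N)
  case 0
  show ?case using x lipschitz_joined_refl by simp
next
  case (Suc N)
  let ?A = "lambda_axis lam a K" and ?y = "(prox K h ^^ N) x"
  have y: "?y \<in> ?A" using Suc by blast
  have inA: "prox K s ?y \<in> ?A" if "s \<in> {0..h}" for s
    using that h by (intro prox_in_lambda_axis[OF K(1,2) _ _ a y]) auto
  have RM: "RK K w \<le> Rmax K" if "w \<in> ?A" for w
  proof -
    have "a < RK K w" using lambda_axis_subset[OF a(2)] that not_in_offset_iff by blast
    then have "0 < RK K w" using a by linarith
    then show ?thesis by (intro RK_le_Rmax K not_mem_of_RK_pos)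
  qed
  have R0: "0 \<le> Rmax K" using RM[OF y] RK_nonneg[of K ?y] by linarith
  have "(Rmax K / (1 - h))-lipschitz_on {0..h} (\<lambda>s. prox K s ?y)"
  proof (rule lipschitz_onI)
    fix s s' assume s: "s \<in> {0..h}" "s' \<in> {0..h}"
    have "dist (prox K s ?y) (prox K s' ?y) \<le> \<bar>s - s'\<bar> * RK K (prox K s ?y) / (1 - s')"
      using s h by (intro prox_Lipschitz_time K) auto
    also have "\<dots> \<le> \<bar>s - s'\<bar> * Rmax K / (1 - h)"
      using s h R0 RM[OF inA[OF s(1)]] by (intro frac_le mult_left_mono mult_nonneg_nonneg) auto
    finally show "dist (prox K s ?y) (prox K s' ?y) \<le> Rmax K / (1 - h) * dist s s'"
      by (simp add: dist_real_def mult.commute)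
  qed (use R0 h in simp)
  then have "lipschitz_joined ?A (Rmax K / (1 - h) * h) (prox K 0 ?y) (prox K h ?y)"
    using inA h by (intro lipschitz_joined_segment) auto
  then have step: "lipschitz_joined ?A (Rmax K / (1 - h) * h) ?y (prox K h ?y)"
    by (simp add: prox_0[OF K(1,2)])
  have "lipschitz_joined ?A (real N * (Rmax K / (1 - h) * h) + Rmax K / (1 - h) * h) x (prox K h ?y)"
    using Suc step by (blast intro: lipschitz_joined_trans)
  moreover have "real N * (Rmax K / (1 - h) * h) + Rmax K / (1 - h) * h = real (Suc N) * (Rmax K / (1 - h) * h)"
    unfolding of_nat_Suc distrib_right by simp
  ultimately show ?case using inA[of h] h by simp
qed

lemma prox_iterate_Lipschitz:
  fixes K :: "'a::euclidean_space set"
  assumes K: "closed K" "K \<noteq> {}" and h: "0 \<le> h" "h < 1"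
  shows "dist ((prox K h ^^ N) x) ((prox K h ^^ N) y) \<le> (1 / (1 - h)) ^ N * dist x y"
proof (induction N)
  case (Suc N)
  have "dist ((prox K h ^^ Suc N) x) ((prox K h ^^ Suc N) y) \<le> dist ((prox K h ^^ N) x) ((prox K h ^^ N) y) / (1 - h)"
    using prox_Lipschitz[OF K h] by simp
  also have "\<dots> \<le> (1 / (1 - h)) ^ N * dist x y / (1 - h)" using Suc h by (intro divide_right_mono) auto
  finally show ?case by simp
qed simp

section \<open>The length estimate\<close>

text \<open>Points at distance less than \<open>RK K x - a\<close> from \<open>x\<close> avoid the
  offset, and geodesic distance dominates the norm. The extreme distance itself may lead into the
  offset, hence the approximation from below.\<close>

lemma Gdiam_ge_RK:
  fixes K :: "'a::euclidean_space set"
  assumes "a < RK K x"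
  shows "ereal (RK K x - a) \<le> Gdiam (- offset K a)"
proof (rule dense_le_bounded)
  show "0 < ereal (RK K x - a)" using assms by simp
  fix w assume "0 < w" "w < ereal (RK K x - a)"
  then obtain s where w: "w = ereal s" and s: "0 < s" "s < RK K x - a" by (cases w) auto
  obtain b :: 'a where b: "b \<in> Basis" using nonempty_Basis by blast
  define y where "y = x + s *\<^sub>R b"
  have d: "dist x y = s" using b s by (simp add: y_def dist_norm)
  have "a < RK K y" using infdist_triangle[of x K y] d s by (simp add: RK_def)
  then have "x \<in> - offset K a" "y \<in> - offset K a" using assms not_in_offset_iff by blast+
  then have "geodist (- offset K a) x y \<le> Gdiam (- offset K a)"
    unfolding Gdiam_def by (meson SUP_upper SUP_upper2)
  then show "w \<le> Gdiam (- offset K a)"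
    using order_trans[OF dist_le_geodist[of x y "- offset K a"]] d w by simp
qed

text \<open>The estimate produced by the retraction, with \<open>u = R\<^sub>m\<^sub>a\<^sub>x / \<alpha>\<close> and \<open>m = 1 / \<mu>\<^sup>2\<close>, against the
  claimed one. For \<open>u > e\<close> the first term may be larger, but the excess is absorbed by the second
  one since \<open>D \<ge> R\<^sub>m\<^sub>a\<^sub>x - \<alpha>\<close>.\<close>

lemma retraction_bound_le:
  fixes u m D \<rho> a :: real
  assumes a: "0 < a" "a \<le> \<rho>" and u: "u = \<rho> / a" and m: "1 \<le> m" and D: "\<rho> - a \<le> D" "0 \<le> D"
  shows "2 * \<rho> * (m * ln u) + exp (m * ln u) * D \<le> 2 * \<rho> * m + D * exp (m * u)"
proof -
  have u1: "1 \<le> u" using a by (simp add: u)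
  have lu: "ln u \<le> u - 1" using u1 by (intro ln_le_minus_one) simp
  have \<rho>: "0 < \<rho>" using a by simp
  show ?thesis
  proof (cases "ln u \<le> 1")
    case True
    have "2 * \<rho> * (m * ln u) \<le> 2 * \<rho> * m" using True m \<rho> by simp
    moreover have "exp (m * ln u) * D \<le> exp (m * u) * D"
      using lu m D by (intro mult_right_mono) auto
    ultimately show ?thesis by (simp only: mult.commute[of D] add_mono)
  next
    case False
    then have u2: "2 \<le> u" using lu by simp
    have E: "u \<le> exp (m * ln u)"
    proof -
      have "1 * ln u \<le> m * ln u" using m u1 by (intro mult_right_mono) auto
      then have "exp (ln u) \<le> exp (m * ln u)" by simp
      then show ?thesis using u1 by simp
    qed
    \<comment> \<open>Replacing \<open>ln u\<close> by \<open>u\<close> in the exponent gains a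
      factor \<open>exp m\<close>, at least \<open>1 + m\<close>; this is the room that absorbs the
      first term.\<close>
    have "m * ln u + m \<le> m * u" using mult_left_mono[OF lu, of m] m by (simp add: algebra_simps)
    then have "exp (m * ln u) * exp m \<le> exp (m * u)" by (simp add: exp_add[symmetric])
    moreover have "exp (m * ln u) * (1 + m) \<le> exp (m * ln u) * exp m"
      by (intro mult_left_mono exp_ge_add_one_self) simp
    ultimately have 1: "m * exp (m * ln u) \<le> exp (m * u) - exp (m * ln u)" by (simp add: algebra_simps)
    have "m * u \<le> m * exp (m * ln u)" using E m by (intro mult_left_mono) auto
    then have 2: "m * u \<le> exp (m * u) - exp (m * ln u)" using 1 by linarith
    \<comment> \<open>The 4 is chosen so that the excess becomes at most \<open>\<rho> / 2\<close>
      times \<open>m * u\<close>, matching \<open>D2\<close>.\<close>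
    have "ln (u / 4) \<le> u / 4 - 1" using u1 by (intro ln_le_minus_one) simp
    moreover have "ln (u / 4) = ln u - ln (2 * 2)" using u1 by (simp add: ln_div)
    moreover have "ln (2 * 2 :: real) = ln 2 + ln 2" by (intro ln_mult_pos) simp_all
    moreover have "ln (2 :: real) \<le> 2 - 1" by (rule ln_le_minus_one) simp
    ultimately have 3: "ln u - 1 \<le> u / 4" by linarith
    have "2 * a \<le> \<rho>" using u2 a by (simp add: u field_simps)
    then have D2: "\<rho> / 2 \<le> D" using D by linarith
    have "2 * \<rho> * m * (ln u - 1) \<le> 2 * \<rho> * m * (u / 4)" using 3 \<rho> m by (intro mult_left_mono) auto
    also have "\<dots> = \<rho> / 2 * (m * u)" by simp
    also have "\<dots> \<le> D * (exp (m * u) - exp (m * ln u))"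
      using D2 2 D m u1 by (intro mult_mono) auto
    finally show ?thesis by (simp add: algebra_simps)
  qed
qed

text \<open>The route goes from \<open>x\<close> to \<open>f x\<close>, along the image of an almost
  shortest path to \<open>f y\<close>, and back to \<open>y\<close>. \<open>T\<close> bounds the
  total time \<open>N * h\<close>; its summand \<open>h\<close> pays for rounding up the number of
  steps.\<close>

lemma geodist_lambda_axis_le_step:
  fixes K :: "'a::euclidean_space set"
  assumes K: "closed K" "K \<noteq> {}" "bounded (- K)" and h: "0 < h" "h < 1" and a: "0 < a" "0 < lam"
    and m: "0 < m" "m \<le> 1"
    and slope: "\<And>y. a < RK K y \<Longrightarrow> y \<notin> lambda_axis lam a K \<Longrightarrow> m * RK K y \<le> norm (y - foot K y)"
    and x: "x \<in> lambda_axis lam a K" "y \<in> lambda_axis lam a K"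
    and D: "geodist (- offset K a) x y \<le> ereal D" "0 \<le> D"
  defines "T \<equiv> 2 * ln (Rmax K / a) / ((2 - h) * m\<^sup>2) + h"
  shows "geodist (lambda_axis lam a K) x y \<le> ereal (2 * (T * (Rmax K / (1 - h))) + exp (T / (1 - h)) * (D + h))"
proof -
  let ?A = "lambda_axis lam a K"
  have outside: "?A \<subseteq> - offset K a" by (rule lambda_axis_subset[OF a(2)])
  have "a < RK K x" using outside x not_in_offset_iff by blast
  moreover from this a have "RK K x \<le> Rmax K" by (intro RK_le_Rmax K not_mem_of_RK_pos) simp
  ultimately have aR: "a < Rmax K" by linarith
  define L where "L = ln (Rmax K / a)"
  have L: "0 \<le> L" using aR a by (simp add: L_def)
  define z where "z = h * (2 - h) * m\<^sup>2"
  have z: "0 < z" using h m by (simp add: z_def)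
  \<comment> \<open>Enough steps for \<open>exp (- (N * z))\<close> to fall below the square of
    \<open>a / Rmax K\<close>.\<close>
  define N where "N = nat \<lceil>2 * L / z\<rceil>"
  have N1: "2 * L / z \<le> real N" unfolding N_def by linarith
  have "0 \<le> 2 * L / z" using L z by simp
  then have N2: "real N \<le> 2 * L / z + 1" unfolding N_def by linarith
  have "real N * h \<le> (2 * L / z + 1) * h" using N2 h by (intro mult_right_mono) auto
  also have "\<dots> = T" using h m by (simp add: T_def z_def L_def field_simps)
  finally have NT: "real N * h \<le> T" .
  have T0: "0 \<le> T" using order_trans[OF _ NT, of 0] h by simp
  have "(1 - z) ^ N \<le> exp (- z) ^ N"
  proof (rule power_mono)
    show "1 - z \<le> exp (- z)" using exp_ge_add_one_self[of "- z"] by simp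
    have "1 - h * (2 - h) = (1 - h)\<^sup>2" by (simp add: power2_eq_square algebra_simps)
    then have "h * (2 - h) \<le> 1" using zero_le_power2[of "1 - h"] by linarith
    then show "0 \<le> 1 - z" unfolding z_def using h m by (auto intro!: mult_le_one power_le_one)
  qed
  also have "\<dots> = exp (- (real N * z))" by (simp add: exp_of_nat_mult[symmetric])
  also have "\<dots> \<le> exp (- (2 * L))" using N1 z by (simp add: field_simps)
  also have "\<dots> = (a / Rmax K)\<^sup>2"
  proof -
    have "exp (- L) = a / Rmax K" using a aR by (simp add: L_def exp_minus)
    then show ?thesis using exp_double[of "- L"] by simp
  qed
  finally have "(1 - z) ^ N * (Rmax K)\<^sup>2 \<le> (a / Rmax K)\<^sup>2 * (Rmax K)\<^sup>2" by (intro mult_right_mono) auto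
  then have NN: "(1 - h * (2 - h) * m\<^sup>2) ^ N * (Rmax K)\<^sup>2 \<le> a\<^sup>2"
    using a aR by (simp add: z_def power_divide)
  define f where "f = prox K h ^^ N"
  have fA: "f w \<in> ?A" if "w \<in> - offset K a" for w
    unfolding f_def
    using h a that not_in_offset_iff
    by (intro prox_iterate_in_lambda_axis[OF K _ h(2) _ a(2) m slope NN]) auto
  define C where "C = (1 / (1 - h)) ^ N"
  have C0: "0 \<le> C" using h by (simp add: C_def)
  have fL: "dist (f u) (f v) \<le> C * dist u v" for u v
    unfolding f_def C_def using h by (intro prox_iterate_Lipschitz K) auto
  have Cexp: "C \<le> exp (T / (1 - h))"
  proof -
    \<comment> \<open>Turns the Lipschitz constant of one step into an exponential, so that
      \<open>N\<close> steps only see the total time.\<close>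
    have "1 / (1 - h) = 1 + h / (1 - h)" using h by (simp add: field_simps)
    also have "\<dots> \<le> exp (h / (1 - h))" by (rule exp_ge_add_one_self)
    finally have "C \<le> exp (h / (1 - h)) ^ N" unfolding C_def using h by (intro power_mono) auto
    also have "\<dots> = exp (real N * h / (1 - h))" by (simp add: exp_of_nat_mult[symmetric])
    also have "\<dots> \<le> exp (T / (1 - h))" using NT h by (simp add: divide_right_mono)
    finally show ?thesis .
  qed
  have cA: "compact ?A" using a by (intro compact_lambda_axis K) auto
  \<comment> \<open>The complement of the offset is open, so the infimum may not be attained; the
    slack \<open>h\<close> vanishes in the limit.\<close>
  have "geodist (- offset K a) x y < ereal (D + h)" using h by (intro le_less_trans[OF D(1)]) simp
  then obtain g where g: "rectifiable_path g" "path_image g \<subseteq> - offset K a" "pathstart g = x" "pathfinish g = y"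
    "path_length g < ereal (D + h)"
    unfolding geodist_def INF_less_iff by blast
  have flen: "path_length (f \<circ> g) \<le> ereal (C * (D + h))"
    using g(5) by (intro path_length_comp_le fL C0) simp
  have "C-lipschitz_on UNIV f" using fL C0 by (intro lipschitz_onI) auto
  then have "continuous_on (path_image g) f"
    using continuous_on_subset[OF lipschitz_on_continuous_on] by blast
  then have "path (f \<circ> g)" using g(1) by (intro path_continuous_image) (auto simp: rectifiable_path_def)
  then have "rectifiable_path (f \<circ> g)" using flen by (auto simp: rectifiable_path_def)
  moreover have "path_image (f \<circ> g) \<subseteq> ?A" using fA g(2) by (auto simp: path_image_compose)
  moreover have "pathstart (f \<circ> g) = f x" "pathfinish (f \<circ> g) = f y"
    using g(3,4) by (simp_all add: pathstart_compose pathfinish_compose)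
  ultimately have "geodist ?A (f x) (f y) \<le> path_length (f \<circ> g)"
    unfolding geodist_def by (intro INF_lower) simp
  then have mid: "lipschitz_joined ?A (C * (D + h)) (f x) (f y)"
    using flen by (intro lipschitz_joined_of_geodist_le[OF cA]) (rule order_trans)
  define l where "l = real N * (Rmax K / (1 - h) * h)"
  have "lipschitz_joined ?A l x (f x)" "lipschitz_joined ?A l y (f y)"
    unfolding f_def l_def using lipschitz_joined_prox_iterate[OF K] h a x by auto
  then have "lipschitz_joined ?A (l + (C * (D + h) + l)) x y"
    using mid lipschitz_joined_trans lipschitz_joined_sym by metis
  then have "geodist ?A x y \<le> ereal (l + (C * (D + h) + l))" by (rule geodist_le_of_lipschitz_joined)
  also have "l + (C * (D + h) + l) \<le> 2 * (T * (Rmax K / (1 - h))) + exp (T / (1 - h)) * (D + h)"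
  proof -
    have "l = real N * h * (Rmax K / (1 - h))" by (simp add: l_def)
    also have "\<dots> \<le> T * (Rmax K / (1 - h))" using NT h a aR by (intro mult_right_mono) auto
    finally have "l \<le> T * (Rmax K / (1 - h))" .
    moreover have "C * (D + h) \<le> exp (T / (1 - h)) * (D + h)" using Cexp D h by (intro mult_right_mono) auto
    ultimately show ?thesis by linarith
  qed
  finally show ?thesis by simp
qed

text \<open>The left side does not depend on \<open>h\<close>, so \<open>h\<close> may tend to 0
  from the right in the one-step-size bound; then \<open>T\<close> tends to
  \<open>M * L\<close>.\<close>

lemma geodist_lambda_axis_le:
  fixes K :: "'a::euclidean_space set"
  assumes K: "closed K" "K \<noteq> {}" "bounded (- K)" and a: "0 < a" "0 < lam"
    and m: "0 < m" "m \<le> 1"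
    and slope: "\<And>y. a < RK K y \<Longrightarrow> y \<notin> lambda_axis lam a K \<Longrightarrow> m * RK K y \<le> norm (y - foot K y)"
    and x: "x \<in> lambda_axis lam a K" "y \<in> lambda_axis lam a K"
    and D: "geodist (- offset K a) x y \<le> ereal D" "0 \<le> D"
  defines "M \<equiv> 1 / m\<^sup>2"
  defines "L \<equiv> ln (Rmax K / a)"
  shows "geodist (lambda_axis lam a K) x y \<le> ereal (2 * Rmax K * (M * L) + exp (M * L) * D)"
proof -
  let ?G = "geodist (lambda_axis lam a K) x y"
  define T where "T h = 2 * L / ((2 - h) * m\<^sup>2) + h" for h
  define B where "B h = 2 * (T h * (Rmax K / (1 - h))) + exp (T h / (1 - h)) * (D + h)" for h
  have step: "?G \<le> ereal (B h)" if "0 < h" "h < 1" for h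
    unfolding B_def T_def L_def using geodist_lambda_axis_le_step[OF K that a m slope x D] .
  have "ereal (dist x y) \<le> ?G" by (rule dist_le_geodist)
  then obtain G where G: "?G = ereal G" using step[of "1/2"] by (cases ?G) auto
  have "(T \<longlongrightarrow> 2 * L / ((2 - 0) * m\<^sup>2) + 0) (at_right 0)"
    unfolding T_def using m by (intro tendsto_intros) auto
  then have T: "(T \<longlongrightarrow> M * L) (at_right 0)" by (simp add: M_def)
  have "(B \<longlongrightarrow> 2 * (M * L * (Rmax K / (1 - 0))) + exp (M * L / (1 - 0)) * (D + 0)) (at_right 0)"
    unfolding B_def by (intro tendsto_intros T) auto
  then have B: "(B \<longlongrightarrow> 2 * Rmax K * (M * L) + exp (M * L) * D) (at_right 0)"
    by (simp add: mult_ac)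
  have "eventually (\<lambda>h. G \<le> B h) (at_right (0::real))"
    unfolding eventually_at_right_field using step G by (intro exI[of _ 1]) auto
  then have "G \<le> 2 * Rmax K * (M * L) + exp (M * L) * D"
    by (intro tendsto_lowerbound[OF B]) auto
  then show ?thesis using G by simp
qed

theorem theorem9p12:
  fixes K :: "'a::euclidean_space set" and mu alpha lam :: real
  assumes "closed K" and "bounded (- K)"
    and "0 < mu" and "mu \<le> 1" and "0 < alpha" and "0 < lam"
    and "reach_mu mu alpha K > ereal (alpha + lam)"
    and "connected (- offset K alpha)"
    and "Gdiam (- offset K alpha) < \<infinity>"
  shows "(\<forall>x \<in> lambda_axis lam alpha K. \<forall>x' \<in> lambda_axis lam alpha K.
            \<exists>g. path g \<and> path_image g \<subseteq> lambda_axis lam alpha K \<and>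
                pathstart g = x \<and> pathfinish g = x' \<and>
                path_length g = geodist (lambda_axis lam alpha K) x x' \<and>
                path_length g \<le> Gdiam (lambda_axis lam alpha K))
       \<and> Gdiam (lambda_axis lam alpha K) \<le>
           ereal (2 * Rmax K / (mu_tilde mu lam alpha alpha K)\<^sup>2
                  + real_of_ereal (Gdiam (- offset K alpha))
                    * exp (Rmax K / (alpha * (mu_tilde mu lam alpha alpha K)\<^sup>2)))"
proof -
  let ?A = "lambda_axis lam alpha K" and ?m = "mu_tilde mu lam alpha alpha K"
  define D where "D = real_of_ereal (Gdiam (- offset K alpha))"
  let ?B = "2 * Rmax K / ?m\<^sup>2 + D * exp (Rmax K / (alpha * ?m\<^sup>2))"
  have ne: "K \<noteq> {}" using assms(2) not_bounded_UNIV by auto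
  note K = assms(1) ne assms(2)
  have a0: "0 \<le> alpha" using assms(5) by simp
  have m: "0 < ?m" "?m \<le> 1" using mu_tilde_bounds[OF assms(3,4,6,7)] assms(4) by auto
  have slope: "?m * RK K y \<le> norm (y - foot K y)" if "alpha < RK K y" "y \<notin> ?A" for y
    by (rule slope_ge_mu_tilde_off_axis[OF K(1,2) assms(3,4) a0 assms(6,7) that])
  have bound: "geodist ?A x x' \<le> ereal ?B" if x: "x \<in> ?A" "x' \<in> ?A" for x x'
  proof -
    have out: "x \<in> - offset K alpha" "x' \<in> - offset K alpha"
      using x lambda_axis_subset[OF assms(6)] by auto
    then have Rx: "alpha < RK K x" using not_in_offset_iff by blast
    \<comment> \<open>An axis point makes the diameter positive, hence with the assumption finite,
      so passing to a real number loses nothing.\<close>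
    have "0 < ereal (RK K x - alpha)" using Rx by simp
    also have "\<dots> \<le> Gdiam (- offset K alpha)" by (rule Gdiam_ge_RK[OF Rx])
    finally have D: "Gdiam (- offset K alpha) = ereal D" "0 < D"
      using assms(9) unfolding D_def by (cases "Gdiam (- offset K alpha)"; simp)+
    have "geodist (- offset K alpha) x x' \<le> Gdiam (- offset K alpha)"
      unfolding Gdiam_def using out by (meson SUP_upper SUP_upper2)
    then have gD: "geodist (- offset K alpha) x x' \<le> ereal D" using D by simp
    \<comment> \<open>Gives \<open>Rmax K - alpha \<le> D\<close>, the hypothesis under which
      \<open>retraction_bound_le\<close> absorbs the logarithm.\<close>
    have RD: "RK K y \<le> D + alpha" for y
      using Gdiam_ge_RK[of alpha K y] D by (cases "alpha < RK K y") auto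
    have "x \<notin> K" using Rx a0 by (intro not_mem_of_RK_pos) simp
    then have RmD: "Rmax K \<le> D + alpha" unfolding Rmax_def using RD by (intro cSUP_least) auto
    have "RK K x \<le> Rmax K" by (intro RK_le_Rmax K \<open>x \<notin> K\<close>)
    then have aR: "alpha \<le> Rmax K" using Rx by simp
    have m2: "?m\<^sup>2 \<le> 1" using m by (simp add: power_le_one)
    have "geodist ?A x x' \<le> ereal (2 * Rmax K * (1 / ?m\<^sup>2 * ln (Rmax K / alpha)) + exp (1 / ?m\<^sup>2 * ln (Rmax K / alpha)) * D)"
      using D(2) by (intro geodist_lambda_axis_le[OF K assms(5,6) m slope x gD]) auto
    also have "\<dots> \<le> ereal (2 * Rmax K * (1 / ?m\<^sup>2) + D * exp (1 / ?m\<^sup>2 * (Rmax K / alpha)))"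
      using retraction_bound_le[OF assms(5) aR refl, of "1 / ?m\<^sup>2" D] m m2 RmD D by simp
    also have "\<dots> = ereal ?B" by (simp add: mult.commute)
    finally show ?thesis .
  qed
  have "compact ?A" using a0 assms(6) by (intro compact_lambda_axis K) auto
  then have "\<exists>g. path g \<and> path_image g \<subseteq> ?A \<and> pathstart g = x \<and> pathfinish g = x' \<and>
      path_length g = geodist ?A x x' \<and> path_length g \<le> Gdiam ?A"
    if x: "x \<in> ?A" "x' \<in> ?A" for x x'
  proof -
    have "geodist ?A x x' < \<infinity>" using bound[OF x] by auto
    then obtain g where g: "path g" "path_image g \<subseteq> ?A" "pathstart g = x" "pathfinish g = x'"
      "path_length g = geodist ?A x x'"
      using minimal_path_exists[OF \<open>compact ?A\<close>] by metis
    moreover have "geodist ?A x x' \<le> Gdiam ?A"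
      unfolding Gdiam_def using x by (meson SUP_upper SUP_upper2)
    ultimately show ?thesis by auto
  qed
  moreover have "Gdiam ?A \<le> ereal ?B"
    unfolding Gdiam_def using bound by (intro SUP_least) auto
  ultimately show ?thesis unfolding D_def by blast
qed

end
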